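(* Let $T>0$ and let the growth condition (defined in the context) hold for the periodic sequence $\sigma_T$ with $t_k=kT$. The following are equivalent: (i) the impulsive system is strongly UGES over $\mathcal S_{\mathrm{cst}}(T)=\{\sigma_T\}$; (ii) there exist $p\ge1$ and $b>0$ such that for all $x\in X$ and $s\ge0$ $$\int_s^\infty\|U_{\sigma_T}(t,s)x\|^p\,dt+\sum_{k:\ t_k>s}\|U_{\sigma_T}(t_k^-,s)x\|^p\le b^p\|x\|^p;$$ (iii) there exist $p\ge1$, $c>0$ and a functional $\bar V:[0,T]\times X\to\mathbb R_{\ge0}$, Lipschitz on bounded subsets of $X$ uniformly in $\tau$ and continuous in $\tau$, such that $$\bar V(\tau,x)\le c\|x\|^p\ \ \forall\tau\in[0,T],\,x\in X,\qquad \underline D^+\bar V(\tau,x)\le-\|x\|^p\ \ \forall\tau\in[0,T),\,x\in X,$$ $$\bar V(0,Jx)-\bar V(T,x)\le-\|x\|^p\ \ \forall x\in X;$$ (iv) the monodromy operator $S(T)J$ is geometrically stable in the sense that there exist $p\ge1$, $\hat c>0$ and a functional $V_d:X\to\mathbb R_{\ge0}$, Lipschitz on bounded subsets of $X$, such that $$V_d(x)\le\hat c\|x\|^p,\qquad V_d(S(T)Jx)-V_d(x)\le-\|x\|^p,\qquad\forall x\in X.$$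
   Context: Setting. $X$ is a Banach space with norm $\|\cdot\|$; $A:D(A)\subset X\to X$ generates a strongly continuous ($C_0$) semigroup $(S(t))_{t\ge0}$ on $X$; $J\in L(X)$ is bounded, $J\neq0$, $JD(A)\subset D(A)$. For an impulse sequence $\sigma=\{t_k\}_{k\ge1}$ with $t_0:=0<t_1<t_2<\dots$, $t_k\to\infty$, put $\mathbb T_\sigma:=\{t_k:k\ge1\}$. The impulsive system is $\dot x(t)=Ax(t)$ for $t\notin\mathbb T_\sigma$, $x(t)=Jx(t^-)$ for $t\in\mathbb T_\sigma$. Its propagator $U_\sigma(t,s)$, $t\ge s\ge0$, is: $U_\sigma(t,s)=S(t-s)$ if $(s,t]\cap\mathbb T_\sigma=\varnothing$; otherwise, if $t_l<\dots<t_m$ are the impulse times in $(s,t]$, $U_\sigma(t,s)=S(t-t_m)JS(t_m-t_{m-1})J\cdots JS(t_l-s)$. For $s<t_k$, $U_\sigma(t_k^-,s)x:=\lim_{t\uparrow t_k}U_\sigma(t,s)x$. $\kappa_\sigma(t,s):=\#(\mathbb T_\sigma\cap(s,t])$. $\mathcal S_{\mathrm{cst}}(T)$ is the set of sequences with $t_{k+1}-t_k=T$ for all $k\ge0$, i.e. $\{\sigma_T\}$. Strong UGES over a family $\mathcal S$: there exist $M\ge1$, $\alpha>0$, $\rho\in(0,1)$ such that $\|U_\sigma(t,s)\|\le M\rho^{\kappa_\sigma(t,s)}e^{-\alpha(t-s)}$ for all $t\ge s\ge0$ and all $\sigma\in\mathcal S$. Growth condition for $\sigma_T$: there exist a piecewise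 continuous $g:\mathbb R_{\ge0}\to\mathbb R_{>0}$ bounded below by some $c_0>0$, and $\mu>1$, such that $\|U_{\sigma_T}(t,s)x\|\le g(t-s)\mu^{\kappa_{\sigma_T}(t,s)}\|x\|$ for all $t\ge s\ge0$, $x\in X$, and $\sup_{0\le\tau<T}g(\tau)<\infty$. Functionals. $\bar V$ is Lipschitz on bounded subsets of $X$ uniformly in $\tau$ if for every $r>0$ there is $L_r>0$ with $|\bar V(\tau,x)-\bar V(\tau,y)|\le L_r\|x-y\|$ for all $\|x\|,\|y\|<r$ and all $\tau$ (similarly for $V_d$, without $\tau$). $\underline D^+\bar V(\tau,x):=\liminf_{h\downarrow0}h^{-1}\big(\bar V(\tau+h,S(h)x)-\bar V(\tau,x)\big)$. *)

theory Defs
  imports "HOL-Analysis.Analysis"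
begin

definition C0_semigroup :: "(real \<Rightarrow> 'a::banach \<Rightarrow>\<^sub>L 'a) \<Rightarrow> bool" where
  "C0_semigroup S \<longleftrightarrow>
     S 0 = id_blinfun \<and>
     (\<forall>t\<ge>0. \<forall>s\<ge>0. S (t + s) = S t o\<^sub>L S s) \<and>
     (\<forall>x. ((\<lambda>t. blinfun_apply (S t) x) \<longlongrightarrow> x) (at_right 0))"

text \<open>
  The (in general unbounded) operator \<open>A\<close> with domain \<open>D\<close>; the values of \<open>A\<close> outside \<open>D\<close> are
  irrelevant.
\<close>
definition generates_C0_semigroup ::
    "'a set \<Rightarrow> ('a \<Rightarrow> 'a) \<Rightarrow> (real \<Rightarrow> 'a::banach \<Rightarrow>\<^sub>L 'a) \<Rightarrow> bool" where
  "generates_C0_semigroup D A S \<longleftrightarrow>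
     C0_semigroup S \<and>
     D = {x. \<exists>y. ((\<lambda>h. (blinfun_apply (S h) x - x) /\<^sub>R h) \<longlongrightarrow> y) (at_right 0)} \<and>
     (\<forall>x\<in>D. ((\<lambda>h. (blinfun_apply (S h) x - x) /\<^sub>R h) \<longlongrightarrow> A x) (at_right 0))"

text \<open>Index \<open>0\<close> carries the convention \<open>t\<^sub>0 = 0\<close>; it is not an impulse time.\<close>
definition impulse_sequence :: "(nat \<Rightarrow> real) \<Rightarrow> bool" where
  "impulse_sequence \<sigma> \<longleftrightarrow> \<sigma> 0 = 0 \<and> strict_mono \<sigma> \<and> filterlim \<sigma> at_top sequentially"

definition impulse_times :: "(nat \<Rightarrow> real) \<Rightarrow> real set" where
  "impulse_times \<sigma> = {\<sigma> k | k. k \<ge> 1}"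

definition S_cst :: "real \<Rightarrow> (nat \<Rightarrow> real) set" where
  "S_cst T = {\<sigma>. impulse_sequence \<sigma> \<and> (\<forall>k. \<sigma> (Suc k) - \<sigma> k = T)}"

definition periodic_sequence :: "real \<Rightarrow> nat \<Rightarrow> real" where
  "periodic_sequence T k = real k * T"

lemma S_cst_eq:
  assumes "T > 0"
  shows "S_cst T = {periodic_sequence T}"
proof (intro equalityI subsetI)
  fix \<sigma> assume *: "\<sigma> \<in> S_cst T"
  have "\<sigma> k = real k * T" for k
  proof (induction k)
    case (Suc k)
    have "\<sigma> (Suc k) = \<sigma> k + T"
      using * by (simp add: S_cst_def algebra_simps)
    with Suc show ?case by (simp add: algebra_simps)
  qed (use * in \<open>simp add: S_cst_def impulse_sequence_def\<close>)
  then show "\<sigma> \<in> {periodic_sequence T}"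
    by (auto simp: periodic_sequence_def)
next
  fix \<sigma> assume "\<sigma> \<in> {periodic_sequence T}"
  then have \<sigma>: "\<sigma> = (\<lambda>k. real k * T)" by (auto simp: periodic_sequence_def)
  have "filterlim \<sigma> at_top sequentially"
    unfolding \<sigma> using assms
    by (intro filterlim_at_top_mult_tendsto_pos[OF tendsto_const] filterlim_real_sequentially)
  then show "\<sigma> \<in> S_cst T"
    using assms by (auto simp: S_cst_def impulse_sequence_def \<sigma> strict_mono_def algebra_simps)
qed

text \<open>
  For increasing times \<open>us = [u\<^sub>1, \<dots>, u\<^sub>m]\<close> in \<open>(s, t]\<close> this is
  \<open>S(t - u\<^sub>m) J S(u\<^sub>m - u\<^sub>m\<^sub>-\<^sub>1) J \<dots> J S(u\<^sub>1 - s)\<close>.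
\<close>
fun impulsive_product ::
    "(real \<Rightarrow> 'a::banach \<Rightarrow>\<^sub>L 'a) \<Rightarrow> ('a \<Rightarrow>\<^sub>L 'a) \<Rightarrow> real list \<Rightarrow> real \<Rightarrow> real \<Rightarrow> 'a \<Rightarrow>\<^sub>L 'a" where
  "impulsive_product S J [] t s = S (t - s)"
| "impulsive_product S J (u # us) t s = impulsive_product S J us t u o\<^sub>L J o\<^sub>L S (u - s)"

text \<open>Meaningful for \<open>t \<ge> s \<ge> 0\<close>; for an impulse sequence only finitely many impulses lie in \<open>(s, t]\<close>.\<close>
definition propagator ::
    "(real \<Rightarrow> 'a::banach \<Rightarrow>\<^sub>L 'a) \<Rightarrow> ('a \<Rightarrow>\<^sub>L 'a) \<Rightarrow> (nat \<Rightarrow> real) \<Rightarrow> real \<Rightarrow> real \<Rightarrow> 'a \<Rightarrow>\<^sub>L 'a" where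
  "propagator S J \<sigma> t s =
     impulsive_product S J (sorted_list_of_set (impulse_times \<sigma> \<inter> {s<..t})) t s"

definition propagator_left ::
    "(real \<Rightarrow> 'a::banach \<Rightarrow>\<^sub>L 'a) \<Rightarrow> ('a \<Rightarrow>\<^sub>L 'a) \<Rightarrow> (nat \<Rightarrow> real) \<Rightarrow> nat \<Rightarrow> real \<Rightarrow> 'a \<Rightarrow> 'a" where
  "propagator_left S J \<sigma> k s x = Lim (at_left (\<sigma> k)) (\<lambda>t. blinfun_apply (propagator S J \<sigma> t s) x)"

definition impulse_count :: "(nat \<Rightarrow> real) \<Rightarrow> real \<Rightarrow> real \<Rightarrow> nat" where
  "impulse_count \<sigma> t s = card (impulse_times \<sigma> \<inter> {s<..t})"

definition strongly_UGES ::
    "(real \<Rightarrow> 'a::banach \<Rightarrow>\<^sub>L 'a) \<Rightarrow> ('a \<Rightarrow>\<^sub>L 'a) \<Rightarrow> (nat \<Rightarrow> real) set \<Rightarrow> bool" where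
  "strongly_UGES S J \<S> \<longleftrightarrow>
     (\<exists>M \<alpha> \<rho>. M \<ge> 1 \<and> \<alpha> > 0 \<and> 0 < \<rho> \<and> \<rho> < 1 \<and>
        (\<forall>\<sigma>\<in>\<S>. \<forall>s\<ge>0. \<forall>t\<ge>s.
           norm (propagator S J \<sigma> t s) \<le> M * \<rho> ^ impulse_count \<sigma> t s * exp (- \<alpha> * (t - s))))"

text \<open>
  The usual notion on \<open>[0, \<infinity>)\<close>: finite one-sided limits everywhere and finitely many
  discontinuities in each bounded interval.
\<close>
definition piecewise_continuous_nonneg :: "(real \<Rightarrow> real) \<Rightarrow> bool" where
  "piecewise_continuous_nonneg g \<longleftrightarrow>
     (\<forall>t\<ge>0. \<exists>l. (g \<longlongrightarrow> l) (at_right t)) \<and>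
     (\<forall>t>0. \<exists>l. (g \<longlongrightarrow> l) (at_left t)) \<and>
     (\<forall>b. finite {t \<in> {0..b}. \<not> continuous (at t within {0..}) g})"

definition growth_condition ::
    "(real \<Rightarrow> 'a::banach \<Rightarrow>\<^sub>L 'a) \<Rightarrow> ('a \<Rightarrow>\<^sub>L 'a) \<Rightarrow> real \<Rightarrow> bool" where
  "growth_condition S J T \<longleftrightarrow>
     (\<exists>g c0 \<mu>. piecewise_continuous_nonneg g \<and> c0 > 0 \<and> (\<forall>\<tau>\<ge>0. g \<tau> \<ge> c0) \<and> \<mu> > 1 \<and>
        (\<forall>s\<ge>0. \<forall>t\<ge>s. \<forall>x.
           norm (blinfun_apply (propagator S J (periodic_sequence T) t s) x)
             \<le> g (t - s) * \<mu> ^ impulse_count (periodic_sequence T) t s * norm x) \<and>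
        bdd_above (g ` {0..<T}))"

definition lipschitz_on_bounded :: "('a::real_normed_vector \<Rightarrow> real) \<Rightarrow> bool" where
  "lipschitz_on_bounded V \<longleftrightarrow>
     (\<forall>r>0. \<exists>L>0. \<forall>x y. norm x < r \<longrightarrow> norm y < r \<longrightarrow> \<bar>V x - V y\<bar> \<le> L * norm (x - y))"

definition lipschitz_on_bounded_uniformly ::
    "real set \<Rightarrow> (real \<Rightarrow> 'a::real_normed_vector \<Rightarrow> real) \<Rightarrow> bool" where
  "lipschitz_on_bounded_uniformly I V \<longleftrightarrow>
     (\<forall>r>0. \<exists>L>0. \<forall>\<tau>\<in>I. \<forall>x y. norm x < r \<longrightarrow> norm y < r \<longrightarrow>
        \<bar>V \<tau> x - V \<tau> y\<bar> \<le> L * norm (x - y))"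

definition lower_Dini ::
    "(real \<Rightarrow> 'a::banach \<Rightarrow>\<^sub>L 'a) \<Rightarrow> (real \<Rightarrow> 'a \<Rightarrow> real) \<Rightarrow> real \<Rightarrow> 'a \<Rightarrow> ereal" where
  "lower_Dini S V \<tau> x =
     Liminf (at_right 0) (\<lambda>h. ereal ((V (\<tau> + h) (blinfun_apply (S h) x) - V \<tau> x) / h))"

definition geometrically_stable :: "('a::banach \<Rightarrow>\<^sub>L 'a) \<Rightarrow> bool" where
  "geometrically_stable B \<longleftrightarrow>
     (\<exists>p c V. p \<ge> 1 \<and> c > 0 \<and> lipschitz_on_bounded V \<and>
        (\<forall>x. 0 \<le> V x \<and> V x \<le> c * norm x powr p \<and>
             V (blinfun_apply B x) - V x \<le> - (norm x powr p)))"

end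

theory Submission
  imports Defs
begin

text \<open>
  Over a whole period the system acts through a single bounded operator, the monodromy operator
  \<open>B = S(T) J\<close>.  If \<open>s\<close> lies in the period ending at \<open>(i + 1) T\<close> and \<open>t\<close> in the period starting at
  \<open>m T\<close>, where \<open>m = i + 1 + n\<close>, then
  \<open>U(t, s) = S(t - m T) J B\<^sup>n S((i + 1) T - s)\<close>: up to two factors that stay bounded on a
  period, the propagator is a power of \<open>B\<close>.  Each of the four conditions is therefore compared with
  power stability of \<open>B\<close>, that is \<open>\<parallel>B\<^sup>n\<parallel> \<le> M r\<^sup>n\<close> with \<open>r < 1\<close>.

  For strong UGES this is the product formula, the factor \<open>r\<close> per period being shared
  between the jump factor \<open>\<rho>\<close> and the time decay \<open>e\<^sup>-\<^sup>\<alpha>\<^sup>T\<close>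
  (\<open>power_stable_if_strongly_UGES\<close>, \<open>strongly_UGES_if_power_stable\<close>).

  The route from the integral condition and from either Lyapunov functional back to power stability
  is the discrete Datko theorem \<open>power_stable_if_orbits_summable\<close>: it is enough that
  \<open>\<Sum>\<^sub>k \<parallel>B\<^sup>k x\<parallel>\<^sup>p \<le> c \<parallel>x\<parallel>\<^sup>p\<close>.  The left limits at the impulse times started from \<open>J x\<close> at time
  \<open>0\<close> are exactly \<open>B x, B\<^sup>2 x, \<dots>\<close>, so the sum in the integral condition has this form.  A functional
  that drops by \<open>\<parallel>x\<parallel>\<^sup>p\<close> along \<open>B\<close> gives it by telescoping.  A clock-dependent functional \<open>V\<close> reduces
  to that case: the Dini inequality makes \<open>V\<close> nonincreasing along the flow during a period, whence
  \<open>V(T, B x) \<le> V(0, J x) \<le> V(T, x) - \<parallel>x\<parallel>\<^sup>p\<close>, so that \<open>V(T, \<cdot>)\<close> drops along \<open>B\<close>.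

  Conversely, power stability gives all conditions with \<open>p = 1\<close>, because geometric series converge.
  The functional on \<open>X\<close> is \<open>\<Sum>\<^sub>k \<parallel>B\<^sup>k x\<parallel>\<close>.  The clock-dependent one,
  \<open>V(\<tau>, x) = \<integral>\<^sub>0\<^sup>T\<^sup>-\<^sup>\<tau> \<parallel>S(r) x\<parallel> dr + W(S(T - \<tau>) x)\<close>, is the cost accumulated along the whole
  future trajectory, where \<open>W(x) = \<Sum>\<^sub>k \<phi>(B\<^sup>k x)\<close> and \<open>\<phi>(x)\<close> is the cost \<open>\<parallel>x\<parallel>\<close> of a jump plus the
  integral of \<open>\<parallel>S(r) J x\<parallel>\<close> over the period after it.
\<close>
section \<open>Power stability of a bounded operator\<close>

definition power_stable :: "('a::banach \<Rightarrow>\<^sub>L 'a) \<Rightarrow> bool" where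
  "power_stable B \<longleftrightarrow>
     (\<exists>M r. M > 0 \<and> 0 < r \<and> r < 1 \<and>
        (\<forall>n x. norm ((blinfun_apply B ^^ n) x) \<le> M * r ^ n * norm x))"

lemma funpow_blinfun_diff:
  fixes B :: "'a::real_normed_vector \<Rightarrow>\<^sub>L 'a"
  shows "(blinfun_apply B ^^ n) (x - y) = (blinfun_apply B ^^ n) x - (blinfun_apply B ^^ n) y"
  by (induction n) (simp_all add: blinfun.diff_right)

text \<open>
  The constant \<open>r = 2\<^sup>-\<^sup>1\<^sup>/\<^sup>N\<close> spreads the gain of one half, available only every \<open>N\<close> steps, evenly
  over the steps; the incomplete last block costs the factor \<open>2 K\<close>.
\<close>
lemma power_stable_if_iterate_contracts:
  fixes B :: "'a::banach \<Rightarrow>\<^sub>L 'a"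
  assumes "N > 0" and "K > 0"
    and contr: "\<And>x. norm ((blinfun_apply B ^^ N) x) \<le> norm x / 2"
    and bdd: "\<And>n x. norm ((blinfun_apply B ^^ n) x) \<le> K * norm x"
  shows "power_stable B"
proof -
  define r where "r = (1/2::real) powr (1 / N)"
  have r: "0 < r" "r < 1"
    using \<open>N > 0\<close> powr_less_mono2[of "1 / N" "1/2" "1::real"] by (auto simp: r_def)
  have rN: "r ^ N = 1/2"
    using \<open>N > 0\<close> by (simp add: r_def powr_realpow[symmetric] powr_powr)
  have blocks: "norm ((blinfun_apply B ^^ (q * N)) x) \<le> (1/2) ^ q * norm x" for q x
  proof (induction q)
    case (Suc q)
    have "norm ((blinfun_apply B ^^ (Suc q * N)) x)
        = norm ((blinfun_apply B ^^ N) ((blinfun_apply B ^^ (q * N)) x))"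
      by (simp add: funpow_add)
    also have "\<dots> \<le> norm ((blinfun_apply B ^^ (q * N)) x) / 2"
      by (rule contr)
    also have "\<dots> \<le> (1/2) ^ Suc q * norm x"
      using Suc by simp
    finally show ?case .
  qed simp
  have "norm ((blinfun_apply B ^^ n) x) \<le> (2 * K) * r ^ n * norm x" for n x
  proof -
    define q j where "q = n div N" and "j = n mod N"
    have n: "n = q * N + j" and j: "j < N"
      using \<open>N > 0\<close> by (auto simp: q_def j_def)
    have "r ^ N \<le> r ^ j"
      using r j by (intro power_decreasing) auto
    then have "(1/2) ^ q \<le> 2 * (r ^ (q * N) * r ^ j)"
      using r by (simp add: rN mult.commute[of q] power_mult)
    then have half: "(1/2) ^ q \<le> 2 * r ^ n"
      by (simp add: n power_add)
    have "norm ((blinfun_apply B ^^ n) x) \<le> (1/2) ^ q * norm ((blinfun_apply B ^^ j) x)"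
      using blocks[of q "(blinfun_apply B ^^ j) x"] by (simp add: n funpow_add)
    also have "\<dots> \<le> (2 * r ^ n) * (K * norm x)"
      using half bdd[of j x] r by (intro mult_mono) auto
    finally show ?thesis by (simp add: algebra_simps)
  qed
  then show ?thesis
    unfolding power_stable_def using r \<open>K > 0\<close>
    by (intro exI[of _ "2 * K"] exI[of _ r]) auto
qed

lemma le_if_powr_le:
  fixes x y p :: real
  assumes "p > 0" "y \<ge> 0" "x powr p \<le> y powr p"
  shows "x \<le> y"
  using powr_less_mono2[of p y x] assms by (cases "x \<le> y") auto

text \<open>
  The discrete Datko theorem.  The bound makes \<open>\<parallel>B\<^sup>k\<parallel>\<^sup>p \<le> d\<close> for all \<open>k\<close>.  Writing
  \<open>B\<^sup>n x = B\<^sup>n\<^sup>-\<^sup>k B\<^sup>k x\<close> for every \<open>k < n\<close> and adding up gives \<open>n \<parallel>B\<^sup>n x\<parallel>\<^sup>p \<le> d\<^sup>2 \<parallel>x\<parallel>\<^sup>p\<close>, so some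
  power of \<open>B\<close> has norm at most one half.
\<close>
lemma power_stable_if_orbits_summable:
  fixes B :: "'a::banach \<Rightarrow>\<^sub>L 'a"
  assumes "p \<ge> 1"
    and sum: "\<And>n x. (\<Sum>k<n. norm ((blinfun_apply B ^^ k) x) powr p) \<le> c * norm x powr p"
  shows "power_stable B"
proof -
  \<comment> \<open>Inequalities are multiplied by this constant, whereas \<open>c\<close> may be negative on the trivial space.\<close>
  define d where "d = max c 1"
  have d: "d \<ge> 1"
    by (simp add: d_def)
  have sumd: "(\<Sum>k<n. norm ((blinfun_apply B ^^ k) x) powr p) \<le> d * norm x powr p" for n x
  proof -
    have "c * norm x powr p \<le> d * norm x powr p"
      by (intro mult_right_mono) (auto simp: d_def)
    then show ?thesis
      using sum[of x n] by linarith
  qed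
  have each: "norm ((blinfun_apply B ^^ n) x) powr p \<le> d * norm x powr p" for n x
  proof -
    have "norm ((blinfun_apply B ^^ n) x) powr p \<le> (\<Sum>k<Suc n. norm ((blinfun_apply B ^^ k) x) powr p)"
      by (simp add: sum_nonneg)
    then show ?thesis using sumd[of x "Suc n"] by linarith
  qed
  have bdd: "norm ((blinfun_apply B ^^ n) x) \<le> (d powr (1/p)) * norm x" for n x
  proof -
    have "((d powr (1/p)) * norm x) powr p = d * norm x powr p"
      using d \<open>p \<ge> 1\<close> by (simp add: powr_mult powr_powr)
    then have "norm ((blinfun_apply B ^^ n) x) powr p \<le> ((d powr (1/p)) * norm x) powr p"
      using each[of n x] by linarith
    from le_if_powr_le[OF _ _ this] show ?thesis
      using \<open>p \<ge> 1\<close> by simp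
  qed
  have avg: "real n * norm ((blinfun_apply B ^^ n) x) powr p \<le> d\<^sup>2 * norm x powr p" for n x
  proof -
    have split: "(blinfun_apply B ^^ (n - k)) ((blinfun_apply B ^^ k) x) = (blinfun_apply B ^^ n) x"
      if "k < n" for k
      using that funpow_add[of "n - k" k "blinfun_apply B"] by simp
    have "real n * norm ((blinfun_apply B ^^ n) x) powr p
        = (\<Sum>k<n. norm ((blinfun_apply B ^^ (n - k)) ((blinfun_apply B ^^ k) x)) powr p)"
      by (simp add: split)
    also have "\<dots> \<le> (\<Sum>k<n. d * norm ((blinfun_apply B ^^ k) x) powr p)"
      by (intro sum_mono each)
    also have "\<dots> \<le> d * (d * norm x powr p)"
      using d sumd[of x n] by (simp add: sum_distrib_left[symmetric])
    finally show ?thesis by (simp add: power2_eq_square)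
  qed
  obtain N :: nat where N: "real N \<ge> d\<^sup>2 * 2 powr p"
    using real_arch_simple by blast
  have "d\<^sup>2 * 2 powr p > 0" using d by simp
  with N have N0: "N > 0" by (cases N) auto
  have "norm ((blinfun_apply B ^^ N) x) \<le> norm x / 2" for x
  proof -
    have "d\<^sup>2 * (2 powr p * norm ((blinfun_apply B ^^ N) x) powr p)
        \<le> real N * norm ((blinfun_apply B ^^ N) x) powr p"
      using mult_right_mono[OF N, of "norm ((blinfun_apply B ^^ N) x) powr p"]
      by (simp add: mult.assoc)
    also have "\<dots> \<le> d\<^sup>2 * norm x powr p" by (rule avg)
    finally have "(2 * norm ((blinfun_apply B ^^ N) x)) powr p \<le> norm x powr p"
      using d by (simp add: powr_mult)
    then have "2 * norm ((blinfun_apply B ^^ N) x) \<le> norm x"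
      using le_if_powr_le[of p "norm x" "2 * norm ((blinfun_apply B ^^ N) x)"] \<open>p \<ge> 1\<close> by simp
    then show ?thesis by simp
  qed
  then show ?thesis
    using N0 bdd d by (intro power_stable_if_iterate_contracts[of N "d powr (1/p)"]) auto
qed

text \<open>
  The solution \<open>W\<close> of \<open>W(x) - W(B x) = \<phi>(x)\<close> is the series of \<open>\<phi>\<close> along the orbit.  The same
  geometric majorant gives convergence and, applied to the orbit of \<open>x - y\<close>, the Lipschitz constant
  of \<open>W\<close>.
\<close>
lemma power_stable_orbit_series:
  fixes B :: "'a::banach \<Rightarrow>\<^sub>L 'a" and \<phi> :: "'a \<Rightarrow> real"
  assumes "power_stable B" and "K > 0"
    and lip: "\<And>x y. \<bar>\<phi> x - \<phi> y\<bar> \<le> K * norm (x - y)"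
    and nonneg: "\<And>x. \<phi> x \<ge> 0" and zero: "\<phi> 0 = 0"
  obtains W L where "L > 0" "\<And>x. W x \<ge> 0" "\<And>x. W x = \<phi> x + W (blinfun_apply B x)"
    "\<And>x y. \<bar>W x - W y\<bar> \<le> L * norm (x - y)" "W 0 = 0"
proof -
  obtain M r where M: "M > 0" and r: "0 < r" "r < 1"
    and ps: "\<And>n x. norm ((blinfun_apply B ^^ n) x) \<le> M * r ^ n * norm x"
    using assms(1) unfolding power_stable_def by blast
  define W where "W x = (\<Sum>n. \<phi> ((blinfun_apply B ^^ n) x))" for x
  define L where "L = K * M / (1 - r)"
  have diff: "\<bar>\<phi> ((blinfun_apply B ^^ n) x) - \<phi> ((blinfun_apply B ^^ n) y)\<bar>
      \<le> K * M * norm (x - y) * r ^ n" for n x y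
  proof -
    have "\<bar>\<phi> ((blinfun_apply B ^^ n) x) - \<phi> ((blinfun_apply B ^^ n) y)\<bar>
        \<le> K * norm ((blinfun_apply B ^^ n) (x - y))"
      unfolding funpow_blinfun_diff by (rule lip)
    also have "\<dots> \<le> K * (M * r ^ n * norm (x - y))"
      using \<open>K > 0\<close> ps by (intro mult_left_mono) auto
    finally show ?thesis by (simp add: algebra_simps)
  qed
  have zero_orbit: "(blinfun_apply B ^^ n) 0 = 0" for n
    by (induction n) auto
  have geo: "(\<lambda>n. K * M * norm z * r ^ n) sums (L * norm z)" for z :: 'a
    using sums_mult[OF geometric_sums[of r], of "K * M * norm z"] r by (simp add: L_def)
  have summ: "summable (\<lambda>n. \<phi> ((blinfun_apply B ^^ n) x))" for x
    by (rule summable_comparison_test'[OF sums_summable[OF geo[of x]], of 0])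
      (use diff[of _ x 0] in \<open>simp add: zero_orbit zero\<close>)
  show thesis
  proof (rule that)
    show "L > 0" using \<open>K > 0\<close> M r by (simp add: L_def)
    show "W x \<ge> 0" for x
      unfolding W_def by (intro suminf_nonneg summ nonneg)
    show "W x = \<phi> x + W (blinfun_apply B x)" for x
      using suminf_split_head[OF summ[of x]] by (simp add: W_def funpow_swap1)
    show "\<bar>W x - W y\<bar> \<le> L * norm (x - y)" for x y
    proof -
      have s: "summable (\<lambda>n. \<bar>\<phi> ((blinfun_apply B ^^ n) x) - \<phi> ((blinfun_apply B ^^ n) y)\<bar>)"
        by (rule summable_comparison_test'[OF sums_summable[OF geo[of "x - y"]], of 0])
          (use diff in simp)
      have "\<bar>W x - W y\<bar> = \<bar>\<Sum>n. \<phi> ((blinfun_apply B ^^ n) x) - \<phi> ((blinfun_apply B ^^ n) y)\<bar>"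
        unfolding W_def by (simp add: suminf_diff summ)
      also have "\<dots> \<le> (\<Sum>n. \<bar>\<phi> ((blinfun_apply B ^^ n) x) - \<phi> ((blinfun_apply B ^^ n) y)\<bar>)"
        by (rule summable_rabs[OF s])
      also have "\<dots> \<le> (\<Sum>n. K * M * norm (x - y) * r ^ n)"
        using diff s geo by (intro suminf_le sums_summable) auto
      also have "\<dots> = L * norm (x - y)"
        using geo by (simp add: sums_iff)
      finally show ?thesis .
    qed
    show "W 0 = 0" by (simp add: W_def zero_orbit zero)
  qed
qed

lemma lipschitz_on_bounded_if_lipschitz:
  assumes "L > 0" "\<And>x y. \<bar>V x - V y\<bar> \<le> L * norm (x - y)"
  shows "lipschitz_on_bounded V"
  using assms unfolding lipschitz_on_bounded_def by blast

text \<open>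
  The decrease telescopes along an orbit, so \<open>V x\<close> dominates every partial sum of
  \<open>\<parallel>B\<^sup>k x\<parallel>\<^sup>p\<close>.
\<close>
lemma power_stable_if_geometric_decrease:
  fixes B :: "'a::banach \<Rightarrow>\<^sub>L 'a"
  assumes "p \<ge> 1"
    and V: "\<And>x. 0 \<le> V x" "\<And>x. V x \<le> c * norm x powr p"
      "\<And>x. V (blinfun_apply B x) - V x \<le> - (norm x powr p)"
  shows "power_stable B"
proof (rule power_stable_if_orbits_summable[OF \<open>p \<ge> 1\<close>])
  fix n x
  have "(\<Sum>k<n. norm ((blinfun_apply B ^^ k) x) powr p) \<le> V x - V ((blinfun_apply B ^^ n) x)"
  proof (induction n)
    case (Suc n)
    then show ?case
      using V(3)[of "(blinfun_apply B ^^ n) x"] by simp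
  qed simp
  then show "(\<Sum>k<n. norm ((blinfun_apply B ^^ k) x) powr p) \<le> c * norm x powr p"
    using V(1)[of "(blinfun_apply B ^^ n) x"] V(2)[of x] by linarith
qed

lemma geometrically_stable_iff_power_stable:
  fixes B :: "'a::banach \<Rightarrow>\<^sub>L 'a"
  shows "geometrically_stable B \<longleftrightarrow> power_stable B"
proof
  assume "geometrically_stable B"
  then show "power_stable B"
    unfolding geometrically_stable_def by (metis power_stable_if_geometric_decrease)
next
  assume "power_stable B"
  have lip: "\<bar>norm x - norm y\<bar> \<le> 1 * norm (x - y)" for x y :: 'a
    by (simp add: norm_triangle_ineq3)
  obtain W L where W: "L > 0" "\<And>x. W x \<ge> 0" "\<And>x. W x = norm x + W (blinfun_apply B x)"
    "\<And>x y. \<bar>W x - W y\<bar> \<le> L * norm (x - y)" "W 0 = 0"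
    by (rule power_stable_orbit_series[OF \<open>power_stable B\<close> zero_less_one lip norm_ge_zero norm_zero])
      (rule that)
  have "W x \<le> L * norm x" for x using W(4)[of x 0] W(5) by simp
  moreover have "W (blinfun_apply B x) - W x \<le> - norm x" for x using W(3)[of x] by simp
  ultimately show "geometrically_stable B"
    unfolding geometrically_stable_def using W(1,2) lipschitz_on_bounded_if_lipschitz[OF W(1,4)]
    by (intro exI[of _ 1] exI[of _ L] exI[of _ W]) auto
qed

section \<open>Monotonicity from a lower right Dini derivative\<close>

text \<open>
  For each \<open>e > 0\<close> let \<open>m\<close> be the last point at which \<open>f\<close> lies on or below the line through
  \<open>(a, f a)\<close> of slope \<open>e\<close>.  If \<open>m < b\<close>, some difference quotient at \<open>m\<close> is below \<open>e\<close>, which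
  produces a later such point.  The lower limit supplies arbitrarily small increments of
  this kind, and one of them is enough.
\<close>
lemma le_if_lower_Dini_nonpos:
  fixes f :: "real \<Rightarrow> real"
  assumes "a \<le> b" and cont: "continuous_on {a..b} f"
    and dini: "\<And>t. a \<le> t \<Longrightarrow> t < b \<Longrightarrow>
      Liminf (at_right 0) (\<lambda>h. ereal ((f (t + h) - f t) / h)) \<le> 0"
  shows "f b \<le> f a"
proof (rule field_le_epsilon)
  fix e' :: real assume "e' > 0"
  \<comment> \<open>The summand \<open>1\<close> keeps the denominator positive when \<open>a = b\<close>.\<close>
  define e where "e = e' / (b - a + 1)"
  have e: "e > 0" "e * (b - a) \<le> e'"
    using \<open>e' > 0\<close> \<open>a \<le> b\<close> by (auto simp: e_def field_simps)
  define E where "E = {t \<in> {a..b}. f t - e * (t - a) \<le> f a}"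
  have "continuous_on {a..b} (\<lambda>t. f t - e * (t - a))"
    by (intro continuous_intros cont)
  from continuous_closed_preimage[OF this, of "{..f a}"] have "closed E"
    by (simp add: E_def vimage_def Int_def)
  moreover have "a \<in> E" and bdd: "bdd_above E"
    using \<open>a \<le> b\<close> by (auto simp: E_def intro!: bdd_aboveI[of _ b])
  ultimately have m: "Sup E \<in> E"
    by (intro closed_contains_Sup) auto
  have "Sup E = b"
  proof (rule ccontr)
    define m where "m = Sup E"
    assume "Sup E \<noteq> b"
    with m have "a \<le> m" "m < b" "f m - e * (m - a) \<le> f a"
      by (auto simp: E_def m_def)
    have "\<not> ereal e \<le> Liminf (at_right 0) (\<lambda>h. ereal ((f (m + h) - f m) / h))"
      using dini[OF \<open>a \<le> m\<close> \<open>m < b\<close>] e(1)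
      by (metis ereal_less(2) leD order_trans)
    then have "\<exists>\<^sub>F h in at_right 0. ereal ((f (m + h) - f m) / h) < ereal e"
      using Liminf_bounded[of "ereal e" "\<lambda>h. ereal ((f (m + h) - f m) / h)" "at_right 0"]
      unfolding frequently_def not_less by blast
    moreover have "\<forall>\<^sub>F h in at_right 0. 0 < h \<and> h < b - m"
      using \<open>m < b\<close> by (auto simp: eventually_at_right_field intro!: exI[of _ "b - m"])
    ultimately have "\<exists>\<^sub>F h in at_right 0. ereal ((f (m + h) - f m) / h) < ereal e \<and> 0 < h \<and> h < b - m"
      using frequently_eventually_frequently by fastforce
    then obtain h where h: "(f (m + h) - f m) / h < e" "0 < h" "h < b - m"
      by (auto dest!: frequently_ex)
    then have "f (m + h) \<le> f m + e * h" by (simp add: field_simps)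
    with \<open>f m - e * (m - a) \<le> f a\<close> have "m + h \<in> E"
      using h \<open>a \<le> m\<close> by (simp add: E_def algebra_simps)
    then have "m + h \<le> m" unfolding m_def using bdd by (rule cSup_upper)
    with h show False by simp
  qed
  with m e show "f b \<le> f a + e'" by (simp add: E_def)
qed

section \<open>The propagator of the periodic system\<close>

text \<open>
  \<open>C\<close> stands for the bound that the growth condition puts on the semigroup over one period.
\<close>
locale periodic_impulsive_system =
  fixes S :: "real \<Rightarrow> 'a::banach \<Rightarrow>\<^sub>L 'a" and J :: "'a \<Rightarrow>\<^sub>L 'a" and T C :: real
  assumes semigroup: "C0_semigroup S" and T_pos: "T > 0" and C_pos: "C > 0"
    and norm_S_le: "\<And>t. 0 \<le> t \<Longrightarrow> t \<le> T \<Longrightarrow> norm (S t) \<le> C"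
begin

definition monodromy :: "'a \<Rightarrow>\<^sub>L 'a" where
  "monodromy = S T o\<^sub>L J"

abbreviation "\<sigma> \<equiv> periodic_sequence T"

lemma monodromy_apply: "blinfun_apply monodromy x = blinfun_apply (S T) (blinfun_apply J x)"
  by (simp add: monodromy_def)

lemma S_zero: "blinfun_apply (S 0) x = x"
  using semigroup by (simp add: C0_semigroup_def)

lemma S_add: "t \<ge> 0 \<Longrightarrow> s \<ge> 0 \<Longrightarrow> blinfun_apply (S (t + s)) x = blinfun_apply (S t) (blinfun_apply (S s) x)"
  using semigroup by (simp add: C0_semigroup_def)

lemma S_bound:
  assumes "0 \<le> t" "t \<le> T"
  shows "norm (blinfun_apply (S t) x) \<le> C * norm x"
  using norm_blinfun[of "S t" x] mult_right_mono[OF norm_S_le[OF assms], of "norm x"] by simp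

lemma J_bound: "norm (blinfun_apply J x) \<le> norm J * norm x"
  by (rule norm_blinfun)

text \<open>
  For \<open>u \<le> v\<close> the increment is \<open>S(u) (S(v - u) x - x)\<close>, so right continuity at \<open>0\<close> together with
  the bound \<open>C\<close> controls both one-sided increments at once.
\<close>
lemma continuous_on_S: "continuous_on {0..T} (\<lambda>t. blinfun_apply (S t) x)"
  unfolding continuous_on_iff
proof (intro ballI allI impI)
  fix u e :: real assume u: "u \<in> {0..T}" and "e > 0"
  have "((\<lambda>t. blinfun_apply (S t) x) \<longlongrightarrow> x) (at_right 0)"
    using semigroup by (simp add: C0_semigroup_def)
  then have "\<forall>\<^sub>F h in at_right 0. dist (blinfun_apply (S h) x) x < e / C"
    using \<open>e > 0\<close> C_pos by (intro tendstoD) auto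
  then obtain d where d: "d > 0" "\<And>h. 0 < h \<Longrightarrow> h < d \<Longrightarrow> dist (blinfun_apply (S h) x) x < e / C"
    by (auto simp: eventually_at_right_field)
  have close: "norm (blinfun_apply (S v) x - blinfun_apply (S u) x) < e"
    if "0 \<le> u" "u \<le> v" "v \<le> T" "v - u < d" for u v
  proof (cases "u = v")
    case False
    then have "v - u > 0" using that by simp
    have "blinfun_apply (S v) x - blinfun_apply (S u) x
        = blinfun_apply (S u) (blinfun_apply (S (v - u)) x - x)"
      using S_add[of u "v - u" x] that by (simp add: blinfun.diff_right)
    also have "norm \<dots> \<le> C * norm (blinfun_apply (S (v - u)) x - x)"
      using that by (intro S_bound) auto
    also have "\<dots> < e"
      using d(2)[OF \<open>v - u > 0\<close> \<open>v - u < d\<close>] C_pos by (simp add: dist_norm field_simps)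
    finally show ?thesis .
  qed (use \<open>e > 0\<close> in simp)
  have "dist (blinfun_apply (S v) x) (blinfun_apply (S u) x) < e"
    if "v \<in> {0..T}" "dist v u < d" for v
    using that u close[of u v] close[of v u]
    by (cases "u \<le> v") (auto simp: dist_norm norm_minus_commute)
  with d(1) show "\<exists>d>0. \<forall>v\<in>{0..T}. dist v u < d \<longrightarrow>
      dist (blinfun_apply (S v) x) (blinfun_apply (S u) x) < e"
    by blast
qed

lemma S_left_limit:
  assumes "0 < d" "d \<le> T"
  shows "((\<lambda>t. blinfun_apply (S (t - a)) x) \<longlongrightarrow> blinfun_apply (S d) x) (at_left (a + d))"
proof -
  have lim: "((\<lambda>t. blinfun_apply (S t) x) \<longlongrightarrow> blinfun_apply (S d) x) (at d within {0..T})"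
    using continuous_on_S[of x] assms by (auto simp: continuous_on_def)
  have "\<forall>\<^sub>F t in at_left (a + d). a < t \<and> t < a + d"
    using assms by (auto simp: eventually_at_left_field intro!: exI[of _ a])
  moreover have "((\<lambda>t. t - a) \<longlongrightarrow> (a + d) - a) (at_left (a + d))"
    by (intro tendsto_intros)
  ultimately have "filterlim (\<lambda>t. t - a) (at d within {0..T}) (at_left (a + d))"
    unfolding filterlim_at using assms by (auto elim!: eventually_mono)
  from filterlim_compose[OF lim this] show ?thesis .
qed

text \<open>
  A period is the half-open interval \<open>[i T, (i + 1) T)\<close>: propagation from \<open>s\<close> excludes an impulse at
  \<open>s\<close> itself and propagation to \<open>t\<close> includes one at \<open>t\<close>, so in both cases an impulse instant
  belongs to the period that it starts.
\<close>
lemma period_cell: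
  assumes "s \<ge> 0"
  obtains i where "real i * T \<le> s" "s < real (Suc i) * T"
proof
  have "real_of_int \<lfloor>s / T\<rfloor> * T \<le> s" "s < (real_of_int \<lfloor>s / T\<rfloor> + 1) * T" "\<lfloor>s / T\<rfloor> \<ge> 0"
    using assms T_pos by (auto intro: floor_divide_lower floor_divide_upper)
  then show "real (nat \<lfloor>s / T\<rfloor>) * T \<le> s" "s < real (Suc (nat \<lfloor>s / T\<rfloor>)) * T"
    by (auto simp: algebra_simps)
qed

lemma sorted_impulses_between:
  assumes "real i * T \<le> s" "s < real (Suc i) * T" "real m * T \<le> t" "t < real (Suc m) * T"
  shows "sorted_list_of_set (impulse_times \<sigma> \<inter> {s<..t}) = map (\<lambda>k. real k * T) [Suc i..<Suc m]"
proof -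
  have iff: "1 \<le> k \<and> s < real k * T \<and> real k * T \<le> t \<longleftrightarrow> Suc i \<le> k \<and> k < Suc m" for k
  proof
    assume k: "1 \<le> k \<and> s < real k * T \<and> real k * T \<le> t"
    then have "real i * T < real k * T" "real k * T < real (Suc m) * T"
      using assms by auto
    then show "Suc i \<le> k \<and> k < Suc m"
      using T_pos by (simp only: mult_less_cancel_right_pos of_nat_less_iff) auto
  next
    assume "Suc i \<le> k \<and> k < Suc m"
    then have "real (Suc i) * T \<le> real k * T" "real k * T \<le> real m * T" "1 \<le> k"
      using T_pos by auto
    then show "1 \<le> k \<and> s < real k * T \<and> real k * T \<le> t"
      using assms by linarith
  qed
  have set: "impulse_times \<sigma> \<inter> {s<..t} = set (map (\<lambda>k. real k * T) [Suc i..<Suc m])"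
    using iff by (fastforce simp: impulse_times_def periodic_sequence_def simp del: upt_Suc)
  have "sorted_wrt (<) (map (\<lambda>k. real k * T) [Suc i..<Suc m])"
    unfolding sorted_wrt_map using T_pos
    by (intro sorted_wrt_mono_rel[OF _ sorted_wrt_upt]) auto
  then show ?thesis
    unfolding set sorted_list_of_set_sort_remdups strict_sorted_iff
    by (simp add: distinct_remdups_id sorted_sort_id del: upt_Suc)
qed

text \<open>
  Between consecutive impulses the factors regroup as \<open>J S(T) J S(T) \<dots> J = J (S(T) J)\<^sup>n\<close>, which
  is why \<open>n + 1\<close> impulses yield the power \<open>n\<close>.
\<close>
lemma impulsive_product_equidistant:
  "blinfun_apply (impulsive_product S J (map (\<lambda>k. real k * T) [Suc i..<Suc i + Suc n]) t s) x
     = blinfun_apply (S (t - real (Suc i + n) * T))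
         (blinfun_apply J ((blinfun_apply monodromy ^^ n) (blinfun_apply (S (real (Suc i) * T - s)) x)))"
proof (induction n arbitrary: i s x)
  case (Suc n)
  have upt: "[Suc i..<Suc i + Suc (Suc n)] = Suc i # [Suc (Suc i)..<Suc (Suc i) + Suc n]"
    by (subst upt_conv_Cons) auto
  have period: "real (Suc (Suc i)) * T - real (Suc i) * T = T"
    by (simp add: algebra_simps)
  let ?u = "real (Suc i) * T"
  let ?z = "blinfun_apply (S (?u - s)) x"
  have "blinfun_apply (impulsive_product S J (map (\<lambda>k. real k * T) [Suc i..<Suc i + Suc (Suc n)]) t s) x
      = blinfun_apply (impulsive_product S J (map (\<lambda>k. real k * T) [Suc (Suc i)..<Suc (Suc i) + Suc n]) t ?u)
          (blinfun_apply J ?z)"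
    unfolding upt by (simp del: upt_Suc of_nat_Suc)
  also have "\<dots> = blinfun_apply (S (t - real (Suc (Suc i) + n) * T))
      (blinfun_apply J ((blinfun_apply monodromy ^^ n) (blinfun_apply monodromy ?z)))"
    unfolding Suc period by (simp add: monodromy_apply)
  also have "(blinfun_apply monodromy ^^ n) (blinfun_apply monodromy ?z) = (blinfun_apply monodromy ^^ Suc n) ?z"
    unfolding funpow_Suc_right by simp
  finally show ?case by (simp only: add_Suc add_Suc_right)
qed (simp del: of_nat_Suc)

context
  fixes i m s t
  assumes cell: "real i * T \<le> s" "s < real (Suc i) * T" "real m * T \<le> t" "t < real (Suc m) * T"
begin

lemma impulse_count_between: "impulse_count \<sigma> t s = m - i"
proof -
  have "impulse_count \<sigma> t s = length (sorted_list_of_set (impulse_times \<sigma> \<inter> {s<..t}))"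
    by (simp add: impulse_count_def)
  then show ?thesis
    unfolding sorted_impulses_between[OF cell] by (simp del: upt_Suc)
qed

lemma propagator_same_cell:
  assumes "m = i"
  shows "propagator S J \<sigma> t s = S (t - s)"
  unfolding propagator_def sorted_impulses_between[OF cell] using assms by simp

lemma propagator_later_cell:
  assumes "m = Suc i + n"
  shows "blinfun_apply (propagator S J \<sigma> t s) x = blinfun_apply (S (t - real m * T))
    (blinfun_apply J ((blinfun_apply monodromy ^^ n) (blinfun_apply (S (real (Suc i) * T - s)) x)))"
  using impulsive_product_equidistant[of i n t s x] assms
  unfolding propagator_def sorted_impulses_between[OF cell] by (simp del: upt_Suc of_nat_Suc)

end

text \<open>
  On the last stretch before the impulse the propagator is \<open>S(t - a)\<close> applied to a fixed vector, where
  \<open>a\<close> is the preceding impulse time, or \<open>s\<close> if there is none after \<open>s\<close>.  Strong continuity from the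
  left gives the limit.  When \<open>a\<close> is an impulse time the stretch has length \<open>T\<close>, and the flow along it
  completes one more factor \<open>S(T) J\<close>.
\<close>
lemma propagator_left_eq:
  assumes "real i * T \<le> s" "s < real (Suc i) * T"
  shows "propagator_left S J \<sigma> (Suc (i + n)) s x
    = (blinfun_apply monodromy ^^ n) (blinfun_apply (S (real (Suc i) * T - s)) x)"
  unfolding propagator_left_def
proof (rule tendsto_Lim)
  show "((\<lambda>t. blinfun_apply (propagator S J \<sigma> t s) x) \<longlongrightarrow>
      (blinfun_apply monodromy ^^ n) (blinfun_apply (S (real (Suc i) * T - s)) x)) (at_left (\<sigma> (Suc (i + n))))"
  proof (cases n)
    case 0
    have lim: "((\<lambda>t. blinfun_apply (S (t - s)) x) \<longlongrightarrow> blinfun_apply (S (real (Suc i) * T - s)) x)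
        (at_left (\<sigma> (Suc (i + n))))"
      using S_left_limit[of "real (Suc i) * T - s" s x] assms
      by (simp add: periodic_sequence_def 0 algebra_simps)
    have "\<forall>\<^sub>F t in at_left (\<sigma> (Suc (i + n))). s < t \<and> t < real (Suc i) * T"
      using assms by (auto simp: 0 periodic_sequence_def eventually_at_left_field intro!: exI[of _ s])
    then have "\<forall>\<^sub>F t in at_left (\<sigma> (Suc (i + n))).
        blinfun_apply (S (t - s)) x = blinfun_apply (propagator S J \<sigma> t s) x"
      by eventually_elim (use assms in \<open>simp add: propagator_same_cell[of i s i]\<close>)
    from Lim_transform_eventually[OF lim this] show ?thesis by (simp add: 0)
  next
    case (Suc j)
    define y where "y = blinfun_apply J ((blinfun_apply monodromy ^^ j) (blinfun_apply (S (real (Suc i) * T - s)) x))"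
    define m where "m = Suc i + j"
    have \<sigma>: "\<sigma> (Suc (i + n)) = real m * T + T"
      by (simp add: m_def Suc periodic_sequence_def algebra_simps)
    have lim: "((\<lambda>t. blinfun_apply (S (t - real m * T)) y) \<longlongrightarrow> blinfun_apply (S T) y)
        (at_left (\<sigma> (Suc (i + n))))"
      unfolding \<sigma> using T_pos by (intro S_left_limit) auto
    have "\<forall>\<^sub>F t in at_left (\<sigma> (Suc (i + n))). real m * T < t \<and> t < real m * T + T"
      unfolding \<sigma> using T_pos by (auto simp: eventually_at_left_field intro!: exI[of _ "real m * T"])
    then have "\<forall>\<^sub>F t in at_left (\<sigma> (Suc (i + n))).
        blinfun_apply (S (t - real m * T)) y = blinfun_apply (propagator S J \<sigma> t s) x"
    proof eventually_elim
      case (elim t)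
      then have "real m * T \<le> t" "t < real (Suc m) * T" by (auto simp: algebra_simps)
      from propagator_later_cell[OF assms this m_def] show ?case by (simp add: y_def)
    qed
    from Lim_transform_eventually[OF lim this] show ?thesis by (simp add: Suc y_def monodromy_apply)
  qed
qed simp

section \<open>Strong exponential stability is power stability of the monodromy operator\<close>

lemma monodromy_bound: "norm (blinfun_apply monodromy x) \<le> C * norm J * norm x"
proof -
  have "norm (blinfun_apply monodromy x) \<le> C * norm (blinfun_apply J x)"
    using S_bound[of T "blinfun_apply J x"] T_pos by (simp add: monodromy_apply)
  also have "\<dots> \<le> C * (norm J * norm x)"
    using C_pos by (intro mult_left_mono J_bound) auto
  finally show ?thesis by (simp add: mult.assoc)
qed

text \<open>
  Sandwiching gives \<open>B\<^sup>j\<^sup>+\<^sup>2 = S(T) U((j + 1) T, 0) J\<close>, since \<open>U((j + 1) T, 0) = J B\<^sup>j S(T)\<close>.  The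
  powers \<open>0\<close> and \<open>1\<close> do not have this form and are absorbed in the constant.
\<close>
lemma power_stable_if_strongly_UGES:
  assumes "strongly_UGES S J {\<sigma>}"
  shows "power_stable monodromy"
proof -
  obtain M \<alpha> \<rho> where M: "M \<ge> 1" "\<alpha> > 0" and \<rho>: "0 < \<rho>" "\<rho> < 1"
    and uges: "\<And>s t. 0 \<le> s \<Longrightarrow> s \<le> t \<Longrightarrow>
      norm (propagator S J \<sigma> t s) \<le> M * \<rho> ^ impulse_count \<sigma> t s * exp (- \<alpha> * (t - s))"
    using assms unfolding strongly_UGES_def by auto
  define K where "K = 1 + C * norm J * M / \<rho>"
  have K: "K \<ge> 1" using C_pos M \<rho> by (auto simp: K_def)
  have "norm ((blinfun_apply monodromy ^^ n) x) \<le> K * \<rho> ^ n * norm x" for n x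
  proof -
    consider "n = 0" | "n = 1" | j where "n = Suc (Suc j)"
      by (metis One_nat_def not0_implies_Suc)
    then show ?thesis
    proof cases
      case 1
      then show ?thesis using mult_right_mono[OF K, of "norm x"] by simp
    next
      case 2
      have "C * norm J * 1 \<le> C * norm J * M"
        using M C_pos by (intro mult_left_mono) auto
      also have "\<dots> \<le> K * \<rho>"
        using \<rho> by (simp add: K_def field_simps)
      finally have "C * norm J * norm x \<le> K * \<rho> * norm x"
        by (intro mult_right_mono) auto
      then show ?thesis using monodromy_bound[of x] 2 by simp
    next
      case 3
      let ?t = "real (Suc j) * T"
      have t: "0 \<le> ?t" "real (Suc j) * T \<le> ?t" "?t < real (Suc (Suc j)) * T"
        and zero: "real 0 * T \<le> 0" "0 < real (Suc 0) * T"
        using T_pos by auto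
      have count: "impulse_count \<sigma> ?t 0 = Suc j"
        using impulse_count_between[OF zero t(2,3)] by simp
      have apart: "blinfun_apply (propagator S J \<sigma> ?t 0) (blinfun_apply J x)
          = blinfun_apply J ((blinfun_apply monodromy ^^ j) (blinfun_apply monodromy x))"
        using propagator_later_cell[OF zero t(2,3), of j] by (simp add: S_zero monodromy_apply)
      have "norm (propagator S J \<sigma> ?t 0) \<le> M * \<rho> ^ Suc j * exp (- \<alpha> * ?t)"
        using uges[OF order_refl t(1), unfolded count] by simp
      also have "\<dots> \<le> M * \<rho> ^ Suc j"
        using M \<rho> T_pos by (simp add: mult_left_le)
      finally have U: "norm (propagator S J \<sigma> ?t 0) \<le> M * \<rho> ^ Suc j" .
      have "norm ((blinfun_apply monodromy ^^ n) x)
          = norm (blinfun_apply (S T) (blinfun_apply (propagator S J \<sigma> ?t 0) (blinfun_apply J x)))"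
        unfolding apart by (simp add: 3 funpow_swap1 monodromy_apply[symmetric])
      also have "\<dots> \<le> C * norm (blinfun_apply (propagator S J \<sigma> ?t 0) (blinfun_apply J x))"
        using T_pos by (intro S_bound) auto
      also have "\<dots> \<le> C * ((M * \<rho> ^ Suc j) * (norm J * norm x))"
        using C_pos M \<rho> J_bound U
        by (intro mult_left_mono order_trans[OF norm_blinfun] mult_mono) auto
      also have "\<dots> = (C * norm J * M / \<rho>) * \<rho> ^ n * norm x"
        using \<rho> by (simp add: 3 field_simps)
      also have "\<dots> \<le> K * \<rho> ^ n * norm x"
        using \<rho> by (intro mult_right_mono) (auto simp: K_def)
      finally show ?thesis .
    qed
  qed
  then show ?thesis
    unfolding power_stable_def using K \<rho> by (intro exI[of _ K] exI[of _ \<rho>]) auto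
qed

text \<open>
  With \<open>\<rho> = \<surd>r\<close> and \<open>e\<^sup>-\<^sup>\<alpha>\<^sup>T = \<rho>\<close>, each power of \<open>r = \<rho> e\<^sup>-\<^sup>\<alpha>\<^sup>T\<close> pays for one jump and one
  period of time.  With \<open>\<kappa> \<ge> 1\<close> jumps the elapsed time is at most \<open>(\<kappa> + 1) T\<close>, while only
  \<open>\<kappa> - 1\<close> powers of \<open>r\<close> are available; the mismatch \<open>\<rho>\<^sup>3\<close> goes into the constant.
\<close>
lemma strongly_UGES_if_power_stable:
  assumes "power_stable monodromy"
  shows "strongly_UGES S J {\<sigma>}"
proof -
  obtain M r where M: "M > 0" and r: "0 < r" "r < 1"
    and ps: "\<And>n x. norm ((blinfun_apply monodromy ^^ n) x) \<le> M * r ^ n * norm x"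
    using assms unfolding power_stable_def by blast
  define \<rho> where "\<rho> = sqrt r"
  define \<alpha> where "\<alpha> = - ln \<rho> / T"
  define N where "N = 1 + C / \<rho> + C * norm J * M * C / \<rho> ^ 3"
  have \<rho>: "0 < \<rho>" "\<rho> < 1" and r_eq: "r = \<rho>\<^sup>2"
    using r by (auto simp: \<rho>_def)
  have \<alpha>: "\<alpha> > 0" using \<rho> T_pos by (auto simp: \<alpha>_def divide_neg_pos)
  have N: "N \<ge> 1" "C / \<rho> \<le> N" "C * norm J * M * C / \<rho> ^ 3 \<le> N"
    using C_pos M \<rho> by (auto simp: N_def)
  have exp_\<alpha>: "\<rho> ^ Suc \<kappa> \<le> exp (- \<alpha> * d)" if "d \<le> real (Suc \<kappa>) * T" for d \<kappa>
  proof -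
    have "\<rho> ^ Suc \<kappa> = exp (real (Suc \<kappa>) * ln \<rho>)"
      using \<rho> by (simp only: exp_of_nat_mult exp_ln)
    also have "real (Suc \<kappa>) * ln \<rho> = - \<alpha> * (real (Suc \<kappa>) * T)"
      using T_pos by (simp add: \<alpha>_def)
    also have "exp \<dots> \<le> exp (- \<alpha> * d)"
      using that \<alpha> by (simp del: of_nat_Suc)
    finally show ?thesis .
  qed
  have "norm (propagator S J \<sigma> t s) \<le> N * \<rho> ^ impulse_count \<sigma> t s * exp (- \<alpha> * (t - s))"
    if st: "0 \<le> s" "s \<le> t" for s t
  proof -
    obtain i where i: "real i * T \<le> s" "s < real (Suc i) * T"
      using period_cell[OF \<open>0 \<le> s\<close>] .
    obtain m where m: "real m * T \<le> t" "t < real (Suc m) * T"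
      using period_cell[of t] st by auto
    have "real i * T < real (Suc m) * T" using i m st by linarith
    then have "i \<le> m"
      using T_pos by (simp only: mult_less_cancel_right_pos of_nat_less_iff less_Suc_eq_le)
    have count: "impulse_count \<sigma> t s = m - i"
      by (rule impulse_count_between[OF i m])
    have "t - s \<le> real (Suc m) * T - real i * T" using i m by linarith
    also have "\<dots> = real (Suc (m - i)) * T"
      using \<open>i \<le> m\<close> by (simp add: of_nat_diff algebra_simps)
    finally have expo: "\<rho> ^ Suc (m - i) \<le> exp (- \<alpha> * (t - s))" by (rule exp_\<alpha>)
    have core: "norm (propagator S J \<sigma> t s) \<le> N * \<rho> ^ (m - i) * \<rho> ^ Suc (m - i)"
    proof (cases "m = i")
      case True
      have "t - s \<le> T" using i m True by (simp add: algebra_simps)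
      then have "norm (propagator S J \<sigma> t s) \<le> C"
        using norm_S_le[of "t - s"] st propagator_same_cell[OF i m True] by simp
      also have "\<dots> \<le> N * \<rho>" using N \<rho> by (simp add: field_simps)
      finally show ?thesis using True by simp
    next
      case False
      with \<open>i \<le> m\<close> obtain n where n: "m = Suc i + n"
        by (metis add_Suc le_Suc_ex le_neq_implies_less less_eq_Suc_le)
      have "norm (blinfun_apply (propagator S J \<sigma> t s) x)
          \<le> (N * \<rho> ^ (m - i) * \<rho> ^ Suc (m - i)) * norm x" for x
      proof -
        let ?y = "blinfun_apply (S (real (Suc i) * T - s)) x"
        have "norm (blinfun_apply (propagator S J \<sigma> t s) x)
            = norm (blinfun_apply (S (t - real m * T)) (blinfun_apply J ((blinfun_apply monodromy ^^ n) ?y)))"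
          by (simp only: propagator_later_cell[OF i m n])
        also have "\<dots> \<le> C * norm (blinfun_apply J ((blinfun_apply monodromy ^^ n) ?y))"
          using m by (intro S_bound) (auto simp: algebra_simps)
        also have "\<dots> \<le> C * (norm J * (M * r ^ n * (C * norm x)))"
        proof -
          have y: "norm ?y \<le> C * norm x"
            using i by (intro S_bound) (auto simp: algebra_simps)
          have "norm ((blinfun_apply monodromy ^^ n) ?y) \<le> M * r ^ n * (C * norm x)"
            using M r by (intro order_trans[OF ps] mult_left_mono y) auto
          then show ?thesis
            using C_pos by (intro mult_left_mono order_trans[OF J_bound]) auto
        qed
        also have "\<dots> = (C * norm J * M * C / \<rho> ^ 3) * (\<rho> ^ (m - i) * \<rho> ^ Suc (m - i) * norm x)"
          using \<rho> by (simp add: n r_eq power_mult_distrib power2_eq_square power3_eq_cube field_simps)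
        also have "\<dots> \<le> N * (\<rho> ^ (m - i) * \<rho> ^ Suc (m - i) * norm x)"
          using \<rho> by (intro mult_right_mono N) auto
        finally show ?thesis by (simp add: mult.assoc)
      qed
      then show ?thesis
        using N \<rho> by (intro norm_blinfun_bound) auto
    qed
    also have "\<dots> \<le> N * \<rho> ^ (m - i) * exp (- \<alpha> * (t - s))"
      using N \<rho> by (intro mult_left_mono expo) auto
    finally show ?thesis by (simp only: count)
  qed
  then show ?thesis
    unfolding strongly_UGES_def using N \<alpha> \<rho>
    by (intro exI[of _ N] exI[of _ \<alpha>] exI[of _ \<rho>]) auto
qed

section \<open>Integral characterisation\<close>

text \<open>
  Starting at \<open>J x\<close> makes the left limits at the impulses equal to
  \<open>B\<^sup>k x\<close> with \<open>k \<ge> 1\<close>; the missing term \<open>k = 0\<close> is the summand \<open>1\<close> in the constant.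
\<close>
lemma power_stable_if_orbits_integrable:
  assumes "p \<ge> 1" and "b > 0"
    and int: "\<And>x s. s \<ge> 0 \<Longrightarrow>
      (\<integral>\<^sup>+t\<in>{s..}. ennreal (norm (blinfun_apply (propagator S J \<sigma> t s) x) powr p) \<partial>lborel)
      + (\<Sum>k. if s < \<sigma> k then ennreal (norm (propagator_left S J \<sigma> k s x) powr p) else 0)
      \<le> ennreal (b powr p * norm x powr p)"
  shows "power_stable monodromy"
proof (rule power_stable_if_orbits_summable[OF \<open>p \<ge> 1\<close>])
  fix n x
  let ?c = "1 + b powr p * norm J powr p"
  have zero: "real 0 * T \<le> 0" "0 < real (Suc 0) * T" using T_pos by auto
  have left: "propagator_left S J \<sigma> (Suc k) 0 (blinfun_apply J x) = (blinfun_apply monodromy ^^ Suc k) x" for k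
    using propagator_left_eq[OF zero, of k "blinfun_apply J x"]
    by (simp add: funpow_swap1 monodromy_apply)
  have pos: "0 < \<sigma> (Suc k)" for k using T_pos by (simp add: periodic_sequence_def)
  define f where "f k = (if 0 < \<sigma> k then ennreal (norm (propagator_left S J \<sigma> k 0 (blinfun_apply J x)) powr p) else 0)" for k
  have f_Suc: "f (Suc k) = ennreal (norm ((blinfun_apply monodromy ^^ Suc k) x) powr p)" for k
    by (simp only: f_def pos left if_True)
  have "ennreal (\<Sum>k<n. norm ((blinfun_apply monodromy ^^ Suc k) x) powr p) = (\<Sum>k<n. f (Suc k))"
    unfolding f_Suc by (rule sum_ennreal[symmetric]) simp
  also have "\<dots> \<le> (\<Sum>k<Suc n. f k)"
    unfolding sum.lessThan_Suc_shift by simp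
  also have "\<dots> \<le> (\<Sum>k. f k)"
    by (intro sum_le_suminf) auto
  also have "\<dots> \<le> ennreal (b powr p * norm (blinfun_apply J x) powr p)"
    using order_trans[OF _ int[OF order_refl, of "blinfun_apply J x"]] unfolding f_def by (simp add: add_increasing)
  finally have "(\<Sum>k<n. norm ((blinfun_apply monodromy ^^ Suc k) x) powr p)
      \<le> b powr p * norm (blinfun_apply J x) powr p"
    by (subst (asm) ennreal_le_iff) auto
  also have "\<dots> \<le> b powr p * (norm J * norm x) powr p"
    using \<open>p \<ge> 1\<close> by (intro mult_left_mono powr_mono2 J_bound) auto
  finally have shifted: "(\<Sum>k<n. norm ((blinfun_apply monodromy ^^ Suc k) x) powr p)
      \<le> b powr p * norm J powr p * norm x powr p"
    by (simp add: powr_mult mult.assoc)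
  have "(\<Sum>k<n. norm ((blinfun_apply monodromy ^^ k) x) powr p)
      \<le> (\<Sum>k<Suc n. norm ((blinfun_apply monodromy ^^ k) x) powr p)"
    by (rule sum_mono2) auto
  also have "\<dots> = norm x powr p + (\<Sum>k<n. norm ((blinfun_apply monodromy ^^ Suc k) x) powr p)"
    unfolding sum.lessThan_Suc_shift by simp
  also have "\<dots> \<le> ?c * norm x powr p"
    using shifted by (simp add: algebra_simps)
  finally show "(\<Sum>k<n. norm ((blinfun_apply monodromy ^^ k) x) powr p) \<le> ?c * norm x powr p" .
qed

lemma nn_integral_exp_decay:
  fixes \<alpha> M s :: real
  assumes "\<alpha> > 0" "M \<ge> 0"
  shows "(\<integral>\<^sup>+t\<in>{s..}. ennreal (M * exp (- \<alpha> * (t - s))) \<partial>lborel) = ennreal (M / \<alpha>)"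
proof -
  have "((\<lambda>t. - (M / \<alpha>) * exp (- \<alpha> * (t - s))) \<longlongrightarrow> - (M / \<alpha>) * 0) at_top"
  proof (intro tendsto_mult tendsto_const filterlim_compose[OF exp_at_bot])
    have "filterlim (\<lambda>t. \<alpha> * (- s + t)) at_top at_top"
      using \<open>\<alpha> > 0\<close>
      by (intro filterlim_tendsto_pos_mult_at_top[OF tendsto_const]
          filterlim_tendsto_add_at_top[OF tendsto_const] filterlim_ident) auto
    then show "filterlim (\<lambda>t. - \<alpha> * (t - s)) at_bot at_top"
      by (simp add: filterlim_uminus_at_bot algebra_simps)
  qed
  moreover have "((\<lambda>t. - (M / \<alpha>) * exp (- \<alpha> * (t - s))) has_real_derivative M * exp (- \<alpha> * (t - s))) (at t)" for t
    using \<open>\<alpha> > 0\<close> by (auto intro!: derivative_eq_intros)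
  ultimately show ?thesis
    using nn_integral_FTC_atLeast[of "\<lambda>t. M * exp (- \<alpha> * (t - s))" s
        "\<lambda>t. - (M / \<alpha>) * exp (- \<alpha> * (t - s))" 0] \<open>M \<ge> 0\<close>
    by simp
qed

text \<open>
  The integral is bounded through the time decay of strong UGES and the sum through
  \<open>propagator_left_eq\<close>, which turns the left limits into powers of the monodromy operator.
\<close>
lemma orbits_integrable_if_power_stable:
  assumes "power_stable monodromy"
  obtains b where "b > 0" "\<And>x s. s \<ge> 0 \<Longrightarrow>
      (\<integral>\<^sup>+t\<in>{s..}. ennreal (norm (blinfun_apply (propagator S J \<sigma> t s) x)) \<partial>lborel)
      + (\<Sum>k. if s < \<sigma> k then ennreal (norm (propagator_left S J \<sigma> k s x)) else 0)
      \<le> ennreal (b * norm x)"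
proof -
  obtain M \<alpha> \<rho> where M: "M \<ge> 1" "\<alpha> > 0" "0 < \<rho>" "\<rho> < 1"
    and uges: "\<And>s t. 0 \<le> s \<Longrightarrow> s \<le> t \<Longrightarrow>
      norm (propagator S J \<sigma> t s) \<le> M * \<rho> ^ impulse_count \<sigma> t s * exp (- \<alpha> * (t - s))"
    using strongly_UGES_if_power_stable[OF assms] unfolding strongly_UGES_def by auto
  obtain K r where K: "K > 0" and r: "0 < r" "r < 1"
    and ps: "\<And>n x. norm ((blinfun_apply monodromy ^^ n) x) \<le> K * r ^ n * norm x"
    using assms unfolding power_stable_def by blast
  show thesis
  proof (rule that)
    show "M / \<alpha> + K * C / (1 - r) > 0"
      using M K r C_pos by (intro add_pos_pos) auto
  next
    fix x and s :: real assume "s \<ge> 0"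
    have "norm (blinfun_apply (propagator S J \<sigma> t s) x) \<le> (M * norm x) * exp (- \<alpha> * (t - s))"
      if "s \<le> t" for t
    proof -
      have "norm (propagator S J \<sigma> t s) \<le> M * \<rho> ^ impulse_count \<sigma> t s * exp (- \<alpha> * (t - s))"
        using uges \<open>s \<ge> 0\<close> that .
      also have "\<dots> \<le> M * exp (- \<alpha> * (t - s))"
        using M by (intro mult_right_mono mult_left_le power_le_one) auto
      finally have "norm (propagator S J \<sigma> t s) * norm x \<le> M * exp (- \<alpha> * (t - s)) * norm x"
        by (intro mult_right_mono) auto
      with norm_blinfun[of "propagator S J \<sigma> t s" x] show ?thesis by (simp add: mult_ac)
    qed
    then have "(\<integral>\<^sup>+t\<in>{s..}. ennreal (norm (blinfun_apply (propagator S J \<sigma> t s) x)) \<partial>lborel)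
        \<le> (\<integral>\<^sup>+t\<in>{s..}. ennreal ((M * norm x) * exp (- \<alpha> * (t - s))) \<partial>lborel)"
      by (intro nn_integral_mono) (auto simp: indicator_def intro!: ennreal_leI)
    also have "\<dots> = ennreal (M * norm x / \<alpha>)"
      using M by (intro nn_integral_exp_decay) auto
    finally have flow: "(\<integral>\<^sup>+t\<in>{s..}. ennreal (norm (blinfun_apply (propagator S J \<sigma> t s) x)) \<partial>lborel)
        \<le> ennreal (M * norm x / \<alpha>)" .
    obtain i where i: "real i * T \<le> s" "s < real (Suc i) * T"
      using period_cell[OF \<open>s \<ge> 0\<close>] .
    \<comment> \<open>The first impulse after \<open>s\<close> has index \<open>i + 1\<close>, from which the geometric majorant starts.\<close>
    define f where "f k = (if s < \<sigma> k then ennreal (norm (propagator_left S J \<sigma> k s x)) else 0)" for k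
    have f_init: "f k = 0" if "k < Suc i" for k
    proof -
      have "real k * T \<le> real i * T" using that T_pos by (intro mult_right_mono) auto
      with i show ?thesis by (simp add: f_def periodic_sequence_def)
    qed
    have f_le: "f (n + Suc i) \<le> ennreal (K * C * norm x * r ^ n)" for n
    proof -
      have "norm (blinfun_apply (S (real (Suc i) * T - s)) x) \<le> C * norm x"
        using i by (intro S_bound) (auto simp: algebra_simps)
      then have "norm (propagator_left S J \<sigma> (Suc (i + n)) s x) \<le> K * r ^ n * (C * norm x)"
        unfolding propagator_left_eq[OF i] using K r
        by (intro order_trans[OF ps] mult_left_mono) auto
      then show ?thesis
        by (simp add: f_def add.commute[of n] ennreal_leI mult_ac)
    qed
    have "(\<Sum>k. f k) = (\<Sum>n. f (n + Suc i))"
      using suminf_offset[of f "Suc i"] f_init by simp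
    also have "\<dots> \<le> (\<Sum>n. ennreal (K * C * norm x * r ^ n))"
      by (intro suminf_le f_le) auto
    also have "\<dots> = ennreal (\<Sum>n. K * C * norm x * r ^ n)"
      using K C_pos r by (intro suminf_ennreal2 summable_mult summable_geometric) auto
    also have "(\<Sum>n. K * C * norm x * r ^ n) = K * C * norm x / (1 - r)"
      using r by (simp add: suminf_mult suminf_geometric summable_geometric)
    finally have jumps: "(\<Sum>k. f k) \<le> ennreal (K * C * norm x / (1 - r))" .
    have "M * norm x / \<alpha> + K * C * norm x / (1 - r) = (M / \<alpha> + K * C / (1 - r)) * norm x"
      by (simp add: algebra_simps add_divide_distrib)
    then have "ennreal (M * norm x / \<alpha>) + ennreal (K * C * norm x / (1 - r))
        = ennreal ((M / \<alpha> + K * C / (1 - r)) * norm x)"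
      using M K C_pos r by (simp flip: ennreal_plus)
    with add_mono[OF flow jumps]
    show "(\<integral>\<^sup>+t\<in>{s..}. ennreal (norm (blinfun_apply (propagator S J \<sigma> t s) x)) \<partial>lborel)
      + (\<Sum>k. if s < \<sigma> k then ennreal (norm (propagator_left S J \<sigma> k s x)) else 0)
      \<le> ennreal ((M / \<alpha> + K * C / (1 - r)) * norm x)"
      by (simp add: f_def)
  qed
qed

section \<open>Clock-dependent Lyapunov functionals\<close>

text \<open>
  Along the flow started at \<open>J x\<close>, the semigroup law turns the Dini derivative of the functional
  into that of the real function \<open>f(\<tau>) = V(\<tau>, S(\<tau>) J x)\<close>, which is therefore nonincreasing on
  \<open>[0, T]\<close>.  Combined with the jump inequality, \<open>V(T, \<cdot>)\<close> drops by \<open>\<parallel>x\<parallel>\<^sup>p\<close> along the monodromy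
  operator.
\<close>
lemma power_stable_if_clock_functional:
  assumes "p \<ge> 1"
    and nonneg: "\<And>\<tau> x. \<tau> \<in> {0..T} \<Longrightarrow> 0 \<le> V \<tau> x"
    and lip: "lipschitz_on_bounded_uniformly {0..T} V"
    and cont: "\<And>x. continuous_on {0..T} (\<lambda>\<tau>. V \<tau> x)"
    and upper: "\<And>\<tau> x. \<tau> \<in> {0..T} \<Longrightarrow> V \<tau> x \<le> c * norm x powr p"
    and flow: "\<And>\<tau> x. \<tau> \<in> {0..<T} \<Longrightarrow> lower_Dini S V \<tau> x \<le> ereal (- (norm x powr p))"
    and jump: "\<And>x. V 0 (blinfun_apply J x) - V T x \<le> - (norm x powr p)"
  shows "power_stable monodromy"
proof (rule power_stable_if_geometric_decrease[OF \<open>p \<ge> 1\<close>])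
  show "0 \<le> V T x" "V T x \<le> c * norm x powr p" for x
    using T_pos by (auto intro: nonneg upper)
  fix x
  let ?y = "blinfun_apply J x"
  define f where "f \<tau> = V \<tau> (blinfun_apply (S \<tau>) ?y)" for \<tau>
  have "f T \<le> f 0"
  proof (rule le_if_lower_Dini_nonpos[of 0 T f])
    \<comment> \<open>One ball contains the whole trajectory, so a single Lipschitz constant serves all \<open>\<tau>\<close>.\<close>
    define R where "R = C * norm ?y + 1"
    have "R > 0" using C_pos by (simp add: R_def add_nonneg_pos)
    then obtain L where L: "L > 0" "\<And>\<tau> u v. \<tau> \<in> {0..T} \<Longrightarrow> norm u < R \<Longrightarrow> norm v < R \<Longrightarrow>
        \<bar>V \<tau> u - V \<tau> v\<bar> \<le> L * norm (u - v)"
      using lip unfolding lipschitz_on_bounded_uniformly_def by meson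
    have R: "norm (blinfun_apply (S \<tau>) ?y) < R" if "\<tau> \<in> {0..T}" for \<tau>
      using S_bound[of \<tau> ?y] that by (simp add: R_def)
    show "continuous_on {0..T} f"
      unfolding continuous_on_def
    proof
      fix a assume a: "a \<in> {0..T}"
      let ?z = "blinfun_apply (S a) ?y"
      have "((\<lambda>\<tau>. blinfun_apply (S \<tau>) ?y) \<longlongrightarrow> ?z) (at a within {0..T})"
        using continuous_on_S a by (auto simp: continuous_on_def)
      then have "((\<lambda>\<tau>. L * norm (blinfun_apply (S \<tau>) ?y - ?z)) \<longlongrightarrow> L * norm (?z - ?z)) (at a within {0..T})"
        by (rule tendsto_mult_left[OF tendsto_norm[OF tendsto_diff[OF _ tendsto_const]]])
      then have zero: "((\<lambda>\<tau>. L * norm (blinfun_apply (S \<tau>) ?y - ?z)) \<longlongrightarrow> 0) (at a within {0..T})"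
        by simp
      have "\<forall>\<^sub>F \<tau> in at a within {0..T}. norm (f \<tau> - V \<tau> ?z) \<le> L * norm (blinfun_apply (S \<tau>) ?y - ?z)"
        using a by (auto simp: eventually_at_filter f_def intro!: always_eventually L R)
      from Lim_null_comparison[OF this zero]
      have "((\<lambda>\<tau>. f \<tau> - V \<tau> ?z) \<longlongrightarrow> 0) (at a within {0..T})" .
      moreover have "((\<lambda>\<tau>. V \<tau> ?z) \<longlongrightarrow> V a ?z) (at a within {0..T})"
        using cont a by (auto simp: continuous_on_def)
      ultimately have "((\<lambda>\<tau>. (f \<tau> - V \<tau> ?z) + V \<tau> ?z) \<longlongrightarrow> 0 + V a ?z) (at a within {0..T})"
        by (rule tendsto_add)
      then show "(f \<longlongrightarrow> f a) (at a within {0..T})" by (simp add: f_def[abs_def])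
    qed
    show "Liminf (at_right 0) (\<lambda>h. ereal ((f (\<tau> + h) - f \<tau>) / h)) \<le> 0" if "0 \<le> \<tau>" "\<tau> < T" for \<tau>
    proof -
      have "\<forall>\<^sub>F h in at_right (0::real). 0 < h"
        by (simp add: eventually_at_right_less)
      then have "\<forall>\<^sub>F h in at_right 0. ereal ((f (\<tau> + h) - f \<tau>) / h)
          = ereal ((V (\<tau> + h) (blinfun_apply (S h) (blinfun_apply (S \<tau>) ?y)) - V \<tau> (blinfun_apply (S \<tau>) ?y)) / h)"
      proof eventually_elim
        case (elim h)
        then show ?case using S_add[of h \<tau> ?y] that by (simp add: f_def add.commute[of \<tau>])
      qed
      then have "Liminf (at_right 0) (\<lambda>h. ereal ((f (\<tau> + h) - f \<tau>) / h))
          = lower_Dini S V \<tau> (blinfun_apply (S \<tau>) ?y)"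
        unfolding lower_Dini_def by (rule Liminf_eq)
      also have "\<dots> \<le> ereal (- (norm (blinfun_apply (S \<tau>) ?y) powr p))"
        using that by (intro flow) auto
      also have "\<dots> \<le> 0" by simp
      finally show ?thesis .
    qed
  qed (use T_pos in simp)
  then show "V T (blinfun_apply monodromy x) - V T x \<le> - (norm x powr p)"
    using jump[of x] by (simp add: f_def S_zero monodromy_apply)
qed

definition orbit_integral :: "real \<Rightarrow> 'a \<Rightarrow> real" where
  "orbit_integral a x = integral {0..a} (\<lambda>r. norm (blinfun_apply (S r) x))"

lemma continuous_on_norm_S:
  "a \<ge> 0 \<Longrightarrow> b \<le> T \<Longrightarrow> continuous_on {a..b} (\<lambda>r. norm (blinfun_apply (S r) x))"
  by (intro continuous_on_norm continuous_on_subset[OF continuous_on_S]) auto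

lemma norm_S_integrable:
  "a \<ge> 0 \<Longrightarrow> b \<le> T \<Longrightarrow> (\<lambda>r. norm (blinfun_apply (S r) x)) integrable_on {a..b}"
  by (intro integrable_continuous_real continuous_on_norm_S)

lemma orbit_integral_nonneg: "a \<le> T \<Longrightarrow> orbit_integral a x \<ge> 0"
  unfolding orbit_integral_def by (intro integral_nonneg norm_S_integrable) auto

lemma orbit_integral_zero: "orbit_integral a 0 = 0"
  by (simp add: orbit_integral_def)

lemma orbit_integral_lipschitz:
  assumes "0 \<le> a" "a \<le> T"
  shows "\<bar>orbit_integral a x - orbit_integral a y\<bar> \<le> T * C * norm (x - y)"
proof -
  have "orbit_integral a x - orbit_integral a y
      = integral {0..a} (\<lambda>r. norm (blinfun_apply (S r) x) - norm (blinfun_apply (S r) y))"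
    unfolding orbit_integral_def using assms by (intro integral_diff[symmetric] norm_S_integrable) auto
  also have "norm \<dots> \<le> (C * norm (x - y)) * (a - 0)"
  proof (rule integral_bound)
    show "continuous_on {0..a} (\<lambda>r. norm (blinfun_apply (S r) x) - norm (blinfun_apply (S r) y))"
      using assms by (intro continuous_on_diff continuous_on_norm_S) auto
    fix r assume "r \<in> {0..a}"
    then have "norm (blinfun_apply (S r) (x - y)) \<le> C * norm (x - y)"
      using assms by (intro S_bound) auto
    then show "norm (norm (blinfun_apply (S r) x) - norm (blinfun_apply (S r) y)) \<le> C * norm (x - y)"
      using norm_triangle_ineq3[of "blinfun_apply (S r) x" "blinfun_apply (S r) y"]
      by (simp add: blinfun.diff_right)
  qed (rule assms)
  also have "\<dots> \<le> (C * norm (x - y)) * T"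
    using assms C_pos by (intro mult_left_mono) auto
  finally show ?thesis by (simp add: mult_ac)
qed

text \<open>
  Moving the state forward by \<open>h\<close> while shortening the horizon by \<open>h\<close> removes exactly the cost of the
  first \<open>h\<close> units of time.
\<close>
lemma orbit_integral_shift:
  assumes "0 \<le> h" "h \<le> a" "a \<le> T"
  shows "orbit_integral (a - h) (blinfun_apply (S h) x) = orbit_integral a x - orbit_integral h x"
proof -
  have "orbit_integral (a - h) (blinfun_apply (S h) x)
      = integral {0..a - h} ((\<lambda>r. norm (blinfun_apply (S r) x)) \<circ> (+) h)"
    unfolding orbit_integral_def
    by (intro integral_cong) (use S_add assms in \<open>auto simp: add.commute[of h]\<close>)
  also have "\<dots> = integral {h..a} (\<lambda>r. norm (blinfun_apply (S r) x))"
    by (subst integral_shift_Icc_real) simp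
  also have "\<dots> = orbit_integral a x - orbit_integral h x"
    using Henstock_Kurzweil_Integration.integral_combine[of 0 h a "\<lambda>r. norm (blinfun_apply (S r) x)"]
      norm_S_integrable[of 0 a x] assms
    by (simp add: orbit_integral_def)
  finally show ?thesis .
qed

lemma orbit_integral_derivative_at_zero:
  "((\<lambda>h. orbit_integral h x / h) \<longlongrightarrow> norm x) (at_right 0)"
proof -
  have "((\<lambda>h. orbit_integral h x) has_real_derivative norm (blinfun_apply (S 0) x)) (at 0 within {0..T})"
    unfolding orbit_integral_def
    using T_pos by (intro integral_has_real_derivative continuous_on_norm_S) auto
  then show ?thesis
    using T_pos
    by (simp add: has_field_derivative_iff at_within_Icc_at_right S_zero orbit_integral_def)
qed

text \<open>
  In \<open>V(\<tau> + h, S(h) x) - V(\<tau>, x)\<close> the \<open>W\<close> terms cancel, because both evaluate \<open>W\<close> at the same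
  state at the end of the period, and the integrals leave \<open>- \<integral>\<^sub>0\<^sup>h \<parallel>S(r) x\<parallel> dr\<close>; the Dini derivative is
  therefore \<open>- \<parallel>x\<parallel>\<close> exactly.  The jump inequality is also an equality: \<open>\<phi>\<close> contains the integral
  that \<open>V(0, J x)\<close> adds.
\<close>
lemma clock_functional_if_power_stable:
  assumes "power_stable monodromy"
  obtains c V where "c > 0" "\<And>\<tau> x. \<tau> \<in> {0..T} \<Longrightarrow> 0 \<le> V \<tau> x"
    "lipschitz_on_bounded_uniformly {0..T} V"
    "\<And>x. continuous_on {0..T} (\<lambda>\<tau>. V \<tau> x)"
    "\<And>\<tau> x. \<tau> \<in> {0..T} \<Longrightarrow> V \<tau> x \<le> c * norm x"
    "\<And>\<tau> x. \<tau> \<in> {0..<T} \<Longrightarrow> lower_Dini S V \<tau> x \<le> ereal (- norm x)"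
    "\<And>x. V 0 (blinfun_apply J x) - V T x \<le> - norm x"
proof -
  define \<phi> where "\<phi> x = norm x + orbit_integral T (blinfun_apply J x)" for x
  define K where "K = 1 + T * C * norm J"
  have K: "K > 0" using T_pos C_pos by (simp add: K_def add_pos_nonneg)
  have \<phi>_lip: "\<bar>\<phi> x - \<phi> y\<bar> \<le> K * norm (x - y)" for x y
  proof -
    have "T * C * norm (blinfun_apply J (x - y)) \<le> T * C * (norm J * norm (x - y))"
      using T_pos C_pos by (intro mult_left_mono J_bound) auto
    then show ?thesis
      using orbit_integral_lipschitz[of T "blinfun_apply J x" "blinfun_apply J y"] T_pos
        norm_triangle_ineq3[of x y]
      by (simp add: \<phi>_def K_def blinfun.diff_right algebra_simps)
  qed
  have \<phi>_nonneg: "\<phi> x \<ge> 0" for x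
    by (simp add: \<phi>_def orbit_integral_nonneg)
  have \<phi>_zero: "\<phi> 0 = 0" by (simp add: \<phi>_def orbit_integral_zero)
  obtain W L where L: "L > 0" and W: "\<And>x. W x \<ge> 0" "\<And>x. W x = \<phi> x + W (blinfun_apply monodromy x)"
    "\<And>x y. \<bar>W x - W y\<bar> \<le> L * norm (x - y)" "W 0 = 0"
    by (rule power_stable_orbit_series[OF assms K \<phi>_lip \<phi>_nonneg \<phi>_zero]) (rule that)
  define V where "V \<tau> x = orbit_integral (T - \<tau>) x + W (blinfun_apply (S (T - \<tau>)) x)" for \<tau> x
  define c where "c = T * C + L * C"
  have c: "c > 0" using T_pos C_pos L by (simp add: c_def add_pos_pos)
  have V_lip: "\<bar>V \<tau> x - V \<tau> y\<bar> \<le> c * norm (x - y)" if "\<tau> \<in> {0..T}" for \<tau> x y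
  proof -
    have "\<bar>W (blinfun_apply (S (T - \<tau>)) x) - W (blinfun_apply (S (T - \<tau>)) y)\<bar>
        \<le> L * norm (blinfun_apply (S (T - \<tau>)) (x - y))"
      unfolding blinfun.diff_right by (rule W)
    also have "\<dots> \<le> L * (C * norm (x - y))"
      using that L by (intro mult_left_mono S_bound) auto
    finally show ?thesis
      using orbit_integral_lipschitz[of "T - \<tau>" x y] that
      by (simp add: V_def c_def algebra_simps)
  qed
  have V_zero: "V \<tau> 0 = 0" for \<tau>
    by (simp add: V_def orbit_integral_zero W(4))
  show thesis
  proof (rule that)
    show "c > 0" by (rule c)
    show V_nonneg: "0 \<le> V \<tau> x" if "\<tau> \<in> {0..T}" for \<tau> x
      using that by (simp add: V_def W(1) orbit_integral_nonneg)
    show "lipschitz_on_bounded_uniformly {0..T} V"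
      unfolding lipschitz_on_bounded_uniformly_def using c V_lip by blast
    show "continuous_on {0..T} (\<lambda>\<tau>. V \<tau> x)" for x
    proof -
      have "continuous_on {0..T} (\<lambda>a. orbit_integral a x)"
        unfolding orbit_integral_def by (intro indefinite_integral_continuous_1 norm_S_integrable) auto
      then have "continuous_on {0..T} (\<lambda>\<tau>. orbit_integral (T - \<tau>) x)"
        by (rule continuous_on_compose2) (auto intro!: continuous_intros)
      moreover have "continuous_on {0..T} (\<lambda>\<tau>. W (blinfun_apply (S (T - \<tau>)) x))"
      proof -
        have "continuous_on UNIV W"
        proof (rule lipschitz_on_continuous_on[of L], rule lipschitz_onI)
          show "dist (W u) (W v) \<le> L * dist u v" for u v
            using W(3)[of u v] by (simp add: dist_norm)
        qed (use L in simp)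
        moreover have "continuous_on {0..T} (\<lambda>\<tau>. blinfun_apply (S (T - \<tau>)) x)"
          by (rule continuous_on_compose2[OF continuous_on_S]) (auto intro!: continuous_intros)
        ultimately show ?thesis
          by (rule continuous_on_compose2) simp
      qed
      ultimately show ?thesis unfolding V_def by (rule continuous_on_add)
    qed
    show "V \<tau> x \<le> c * norm x" if "\<tau> \<in> {0..T}" for \<tau> x
      using V_lip[OF that, of x 0] V_zero[of \<tau>] by simp
    show "lower_Dini S V \<tau> x \<le> ereal (- norm x)" if "\<tau> \<in> {0..<T}" for \<tau> x
    proof -
      have lim: "((\<lambda>h. ereal (- (orbit_integral h x / h))) \<longlongrightarrow> ereal (- norm x)) (at_right 0)"
        by (intro tendsto_intros orbit_integral_derivative_at_zero)
      have "\<forall>\<^sub>F h in at_right 0. 0 < h \<and> h < T - \<tau>"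
        using that by (auto simp: eventually_at_right_field intro!: exI[of _ "T - \<tau>"])
      then have "\<forall>\<^sub>F h in at_right 0. ereal (- (orbit_integral h x / h))
          = ereal ((V (\<tau> + h) (blinfun_apply (S h) x) - V \<tau> x) / h)"
      proof eventually_elim
        case (elim h)
        have split: "T - (\<tau> + h) = T - \<tau> - h" by simp
        have "blinfun_apply (S (T - \<tau> - h)) (blinfun_apply (S h) x) = blinfun_apply (S (T - \<tau>)) x"
          using S_add[of "T - \<tau> - h" h x] elim by simp
        then have "V (\<tau> + h) (blinfun_apply (S h) x) - V \<tau> x = - orbit_integral h x"
          unfolding V_def split using orbit_integral_shift[of h "T - \<tau>" x] elim that by simp
        then show ?case by simp
      qed
      from Lim_transform_eventually[OF lim this]
      have "lower_Dini S V \<tau> x = ereal (- norm x)"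
        unfolding lower_Dini_def by (intro lim_imp_Liminf) auto
      then show ?thesis by simp
    qed
    show "V 0 (blinfun_apply J x) - V T x \<le> - norm x" for x
      using W(2)[of x] by (simp add: V_def \<phi>_def S_zero monodromy_apply orbit_integral_def)
  qed
qed

end

section \<open>The equivalence\<close>

text \<open>
  On \<open>[0, t]\<close> with \<open>t < T\<close> there is no impulse, so the growth condition bounds \<open>S(t)\<close> itself.  At
  \<open>t = T\<close> the propagator already contains a jump, and \<open>S(T) = S(T/2)\<^sup>2\<close> is used instead.
\<close>
lemma growth_condition_bounds_semigroup:
  assumes semigroup: "C0_semigroup S" and "T > 0" and "growth_condition S J T"
  obtains C where "periodic_impulsive_system S T C"
proof -
  obtain g \<mu> where growth: "\<And>s t x. 0 \<le> s \<Longrightarrow> s \<le> t \<Longrightarrow>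
        norm (blinfun_apply (propagator S J (periodic_sequence T) t s) x)
          \<le> g (t - s) * \<mu> ^ impulse_count (periodic_sequence T) t s * norm x"
    and "bdd_above (g ` {0..<T})"
    using assms(3) unfolding growth_condition_def by blast
  then obtain G where "\<forall>t\<in>{0..<T}. g t \<le> G"
    by (auto simp: bdd_above_def)
  then have G: "g t \<le> G" if "0 \<le> t" "t < T" for t
    using that by simp
  define C where "C = max 1 G"
  have C: "C \<ge> 1" by (simp add: C_def)
  have norm_S: "norm (S t) \<le> C" if "0 \<le> t" "t < T" for t
  proof (rule norm_blinfun_bound)
    fix x
    have none: "impulse_times (periodic_sequence T) \<inter> {0<..t} = {}"
    proof -
      have "t < real k * T" if "k \<ge> 1" for k
      proof -
        have "1 * T \<le> real k * T"
          using that \<open>T > 0\<close> by (intro mult_right_mono) auto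
        with \<open>t < T\<close> show ?thesis by simp
      qed
      then show ?thesis
        by (fastforce simp: impulse_times_def periodic_sequence_def)
    qed
    have "norm (blinfun_apply (S t) x) \<le> g t * norm x"
      using growth[of 0 t x] that by (simp add: propagator_def impulse_count_def none)
    also have "\<dots> \<le> C * norm x"
      using G[OF that] by (intro mult_right_mono) (auto simp: C_def)
    finally show "norm (blinfun_apply (S t) x) \<le> C * norm x" .
  qed (use C in simp)
  have norm_ST: "norm (S T) \<le> C * C"
  proof -
    have "S T = S (T / 2) o\<^sub>L S (T / 2)"
      using semigroup \<open>T > 0\<close> unfolding C0_semigroup_def
      by (metis field_sum_of_halves half_gt_zero less_imp_le)
    also have "norm \<dots> \<le> norm (S (T / 2)) * norm (S (T / 2))"
      by (rule norm_blinfun_compose)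
    also have "\<dots> \<le> C * C"
      using \<open>T > 0\<close> C by (intro mult_mono norm_S) auto
    finally show ?thesis .
  qed
  have "C \<le> C * C" using C by simp
  then have "norm (S t) \<le> C * C" if "0 \<le> t" "t \<le> T" for t
    using norm_S[of t] norm_ST that by (cases "t = T") auto
  then show thesis
    using that[of "C * C"] semigroup \<open>T > 0\<close> C by (simp add: periodic_impulsive_system_def)
qed

theorem theorem4p7:
  fixes S :: "real \<Rightarrow> 'a::banach \<Rightarrow>\<^sub>L 'a"
    and J :: "'a \<Rightarrow>\<^sub>L 'a"
    and A :: "'a \<Rightarrow> 'a" and D :: "'a set"
    and T :: real
  defines "\<sigma> \<equiv> periodic_sequence T"
  assumes "generates_C0_semigroup D A S"
    and "J \<noteq> 0" and "blinfun_apply J ` D \<subseteq> D"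
    and "T > 0"
    and "growth_condition S J T"
  shows
    "(strongly_UGES S J (S_cst T)
       \<longleftrightarrow>
      (\<exists>p b. p \<ge> 1 \<and> b > 0 \<and>
        (\<forall>x. \<forall>s\<ge>0.
           (\<integral>\<^sup>+t\<in>{s..}. ennreal (norm (blinfun_apply (propagator S J \<sigma> t s) x) powr p) \<partial>lborel)
           + (\<Sum>k. if s < \<sigma> k then ennreal (norm (propagator_left S J \<sigma> k s x) powr p) else 0)
           \<le> ennreal (b powr p * norm x powr p))))
     \<and>
     (strongly_UGES S J (S_cst T)
       \<longleftrightarrow>
      (\<exists>p c V. p \<ge> 1 \<and> c > 0 \<and>
        (\<forall>\<tau>\<in>{0..T}. \<forall>x. 0 \<le> V \<tau> x) \<and>
        lipschitz_on_bounded_uniformly {0..T} V \<and>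
        (\<forall>x. continuous_on {0..T} (\<lambda>\<tau>. V \<tau> x)) \<and>
        (\<forall>\<tau>\<in>{0..T}. \<forall>x. V \<tau> x \<le> c * norm x powr p) \<and>
        (\<forall>\<tau>\<in>{0..<T}. \<forall>x. lower_Dini S V \<tau> x \<le> ereal (- (norm x powr p))) \<and>
        (\<forall>x. V 0 (blinfun_apply J x) - V T x \<le> - (norm x powr p))))
     \<and>
     (strongly_UGES S J (S_cst T)
       \<longleftrightarrow>
      geometrically_stable (S T o\<^sub>L J))"
    (is "(_ \<longleftrightarrow> ?integral) \<and> (_ \<longleftrightarrow> ?clock) \<and> _")
proof -
  obtain C where "periodic_impulsive_system S T C"
    using growth_condition_bounds_semigroup assms(2,5,6) unfolding generates_C0_semigroup_def by blast
  then interpret periodic_impulsive_system S J T C .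
  have uges: "strongly_UGES S J (S_cst T) \<longleftrightarrow> power_stable monodromy"
    unfolding S_cst_eq[OF \<open>T > 0\<close>]
    using power_stable_if_strongly_UGES strongly_UGES_if_power_stable by blast
  have "power_stable monodromy \<longleftrightarrow> ?integral"
  proof
    assume "power_stable monodromy"
    then obtain b where b: "b > 0" "\<And>x s. s \<ge> 0 \<Longrightarrow>
      (\<integral>\<^sup>+t\<in>{s..}. ennreal (norm (blinfun_apply (propagator S J \<sigma> t s) x)) \<partial>lborel)
      + (\<Sum>k. if s < \<sigma> k then ennreal (norm (propagator_left S J \<sigma> k s x)) else 0)
      \<le> ennreal (b * norm x)"
      unfolding \<sigma>_def by (rule orbits_integrable_if_power_stable) (rule that[unfolded \<sigma>_def])
    \<comment> \<open>Stated separately because the simplifier does not rewrite inside the branches of the conditional.\<close>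
    have one: "norm y powr 1 = norm y" "b powr 1 = b" for y :: 'a
      using b(1) by simp_all
    show ?integral
      by (rule exI[of _ 1], rule exI[of _ b], unfold one) (use b in simp)
  next
    assume ?integral
    then show "power_stable monodromy"
      unfolding \<sigma>_def by (elim exE conjE) (rule power_stable_if_orbits_integrable; blast)
  qed
  moreover have "power_stable monodromy \<longleftrightarrow> ?clock"
  proof
    assume "power_stable monodromy"
    then obtain c V where cV: "c > 0" "\<And>\<tau> x. \<tau> \<in> {0..T} \<Longrightarrow> 0 \<le> V \<tau> x"
      "lipschitz_on_bounded_uniformly {0..T} V"
      "\<And>x. continuous_on {0..T} (\<lambda>\<tau>. V \<tau> x)"
      "\<And>\<tau> x. \<tau> \<in> {0..T} \<Longrightarrow> V \<tau> x \<le> c * norm x"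
      "\<And>\<tau> x. \<tau> \<in> {0..<T} \<Longrightarrow> lower_Dini S V \<tau> x \<le> ereal (- norm x)"
      "\<And>x. V 0 (blinfun_apply J x) - V T x \<le> - norm x"
      by (rule clock_functional_if_power_stable) (rule that)
    show ?clock
      by (rule exI[of _ 1], rule exI[of _ c], rule exI[of _ V], intro conjI ballI allI)
        (use cV in \<open>simp_all add: powr_one del: uminus_ereal.simps\<close>)
  next
    assume ?clock
    then show "power_stable monodromy"
    proof (elim exE conjE)
      fix p c V
      assume "p \<ge> 1" "\<forall>\<tau>\<in>{0..T}. \<forall>x. 0 \<le> V \<tau> x" "lipschitz_on_bounded_uniformly {0..T} V"
        "\<forall>x. continuous_on {0..T} (\<lambda>\<tau>. V \<tau> x)"
        "\<forall>\<tau>\<in>{0..T}. \<forall>x. V \<tau> x \<le> c * norm x powr p"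
        "\<forall>\<tau>\<in>{0..<T}. \<forall>x. lower_Dini S V \<tau> x \<le> ereal (- (norm x powr p))"
        "\<forall>x. V 0 (blinfun_apply J x) - V T x \<le> - (norm x powr p)"
      then show ?thesis
        by (intro power_stable_if_clock_functional[of p V c]) blast+
    qed
  qed
  moreover have "power_stable monodromy \<longleftrightarrow> geometrically_stable (S T o\<^sub>L J)"
    unfolding monodromy_def by (rule geometrically_stable_iff_power_stable[symmetric])
  ultimately show ?thesis
    unfolding uges by blast
qed

end
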